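(* Let $a \ge 0$, let $G$ be a random graph drawn from $G(n,1/2)$, and let $\widehat{A} = \frac{1}{2}S + \frac{a}{\sqrt{n}} J$ be its skewed adjacency matrix. Then the operator norm $\|\widehat{A}\| = \sup_{\|x\|=1}\|\widehat{A}x\|$ satisfies $$\mathbb{E}\|\widehat{A}\| \le \sqrt{n}\sqrt{a^2 + 5/4 + o(1)},$$ where $o(1)$ denotes a quantity tending to $0$ as $n\to\infty$. Moreover, for all $\epsilon \ge 0$, $$\Pr\big[\|\widehat{A}\| \ge \mathbb{E}\|\widehat{A}\| + \epsilon\big] \le \exp(-\epsilon^2/8).$$
   Context: $G(n,1/2)$ is the random graph on vertex set $\{1,\dots,n\}$ in which each of the $n(n-1)/2$ possible edges is present independently with probability $1/2$. The signed adjacency matrix $S$ of $G$ is the symmetric $n\times n$ matrix with $S_{ii}=0$, $S_{ij}=1$ if $ij$ is an edge and $S_{ij}=-1$ otherwise ($i\ne j$). $J$ is the $n\times n$ all-ones matrix. *)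

theory Defs
  imports "HOL-Probability.Probability" "Jordan_Normal_Form.Matrix"
begin

text \<open>A graph on the vertex set \<open>{1..n}\<close> is given by its edge set, a set of two-element
  subsets of \<open>{1..n}\<close>.\<close>

definition possible_edges :: "nat \<Rightarrow> nat set set" where
  "possible_edges n = {e. e \<subseteq> {1..n} \<and> card e = 2}"

definition random_graph :: "nat \<Rightarrow> real \<Rightarrow> nat set set pmf" where
  "random_graph n p =
     map_pmf (\<lambda>f. {e \<in> possible_edges n. f e})
       (Pi_pmf (possible_edges n) False (\<lambda>_. bernoulli_pmf p))"

text \<open>Matrix indices start at 0, so row \<open>i\<close> belongs to the vertex \<open>Suc i\<close>.\<close>

definition signed_adj_mat :: "nat \<Rightarrow> nat set set \<Rightarrow> real Matrix.mat" where
  "signed_adj_mat n E =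
     Matrix.mat n n (\<lambda>(i, j). if i = j then 0 else if {Suc i, Suc j} \<in> E then 1 else - 1)"

definition all_ones_mat :: "nat \<Rightarrow> real Matrix.mat" where
  "all_ones_mat n = Matrix.mat n n (\<lambda>_. 1)"

definition skewed_adj_mat :: "real \<Rightarrow> nat \<Rightarrow> nat set set \<Rightarrow> real Matrix.mat" where
  "skewed_adj_mat a n E =
     (1 / 2) \<cdot>\<^sub>m signed_adj_mat n E + (a / sqrt (real n)) \<cdot>\<^sub>m all_ones_mat n"

definition euclidean_norm :: "real Matrix.vec \<Rightarrow> real" where
  "euclidean_norm x = sqrt (scalar_prod x x)"

text \<open>The supremum is meaningful only for matrices with at least one column.\<close>

definition operator_norm :: "real Matrix.mat \<Rightarrow> real" where
  "operator_norm A =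
     (SUP x \<in> {x \<in> carrier_vec (dim_col A). euclidean_norm x = 1}. euclidean_norm (A *\<^sub>v x))"

end

theory Submission
  imports Defs "HOL-Real_Asymp.Real_Asymp"
begin

text \<open>
  Concentration: the norm is a function \<open>f\<close> of independent fair coins. Testing with a
  near-maximising pair of unit vectors shows that the squared positive drops of \<open>f\<close> under
  flipping one coin sum to at most 4. The entropy method (tensorisation of entropy and Herbst's
  argument) turns this into \<open>E exp (t (f - E f)) \<le> exp (2 t\<^sup>2)\<close>, and Chernoff's bound finishes.

  Expectation: instead of counting closed walks, smooth the quadratic form by a Gaussian. For
  every vector \<open>y\<close> the variable \<open>exp (t y\<^sup>T S y - t\<^sup>2 \<Sum> y\<^sub>i\<^sup>2 y\<^sub>j\<^sup>2)\<close> (sum over \<open>i \<noteq> j\<close>) has mean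
  at most 1, so its integral over a Gaussian prior for \<open>y\<close> has mean at most 1 as well. By Gibbs'
  variational principle the logarithm of that integral dominates, for all unit vectors \<open>x\<close> at
  once, the mean of the exponent under the posterior \<open>N(\<surd>r x, (1 - r)/n I)\<close> minus the relative
  entropy of posterior and prior. Taking as priors \<open>N(\<surd>r \<theta> e, (1 - r)/(u n) I)\<close>, where \<open>e\<close> is the
  normalised all-ones vector and \<open>\<theta>\<close> runs through a grid in \<open>[-1, 1]\<close>, gives, with
  \<open>s = (x \<bullet> e)\<^sup>2\<close> and \<open>t = l \<surd>n\<close>, the uniform bound
  \<open>x\<^sup>T S x / 2 + a \<surd>n s \<le> \<surd>n (c + d (1 - s) + a s + o(1))\<close>, where
  \<open>c = (u - 1 - ln u) / (4 l r) + l / (2 r)\<close> and \<open>d = u / (4 l (1 - r))\<close>.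
  It is linear in \<open>s\<close>, and for suitable \<open>l\<close>, \<open>r\<close>, \<open>u\<close> both its end values are at most
  \<open>\<surd>(a\<^sup>2 + 5/4)\<close>.
\<close>

section \<open>The entropy method for independent fair coins\<close>

text \<open>With \<open>I = possible_edges n\<close> this is the distribution underlying
  \<open>random_graph n (1 / 2)\<close>, including the default value \<open>False\<close> outside
  \<open>I\<close>.\<close>

definition coins :: "'a set \<Rightarrow> ('a \<Rightarrow> bool) pmf" where
  "coins I = Pi_pmf I False (\<lambda>_. bernoulli_pmf (1 / 2))"

abbreviation coin_exp :: "'a set \<Rightarrow> (('a \<Rightarrow> bool) \<Rightarrow> real) \<Rightarrow> real" where
  "coin_exp I \<equiv> measure_pmf.expectation (coins I)"

definition flip :: "'a \<Rightarrow> ('a \<Rightarrow> bool) \<Rightarrow> 'a \<Rightarrow> bool" where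
  "flip i x = x(i := \<not> x i)"

lemma finite_set_coins: "finite I \<Longrightarrow> finite (set_pmf (coins I))"
  unfolding coins_def by (subst set_Pi_pmf) auto

lemma integrable_coins [simp]:
  fixes f :: "('a \<Rightarrow> bool) \<Rightarrow> real"
  shows "finite I \<Longrightarrow> integrable (measure_pmf (coins I)) f"
  by (intro integrable_measure_pmf_finite finite_set_coins)

text \<open>Conditioning on the new coin. This recursion drives the induction for the entropy and
  the invariance under flips.\<close>

lemma coin_exp_insert:
  assumes "finite I" "i \<notin> I"
  shows "coin_exp (insert i I) f =
    (coin_exp I (\<lambda>x. f (x(i := True))) + coin_exp I (\<lambda>x. f (x(i := False)))) / 2"
proof -
  have "coins (insert i I) = bind_pmf (bernoulli_pmf (1/2)) (\<lambda>b. map_pmf (\<lambda>x. x(i := b)) (coins I))"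
    unfolding coins_def using assms by (simp add: Pi_pmf_insert' map_pmf_def)
  also have "measure_pmf.expectation \<dots> f =
      (\<Sum>b\<in>UNIV. pmf (bernoulli_pmf (1/2)) b *\<^sub>R measure_pmf.expectation (map_pmf (\<lambda>x. x(i := b)) (coins I)) f)"
  proof (rule pmf_expectation_bind)
    show "finite (set_pmf (map_pmf (\<lambda>x. x(i := b)) (coins I)))" for b
      using finite_set_coins[OF assms(1)] by simp
  qed auto
  finally show ?thesis by (simp add: UNIV_bool add_divide_distrib fun_upd_def cong: if_cong)
qed

lemma coin_exp_mono:
  assumes "finite I" "\<And>x. f x \<le> g x"
  shows "coin_exp I f \<le> coin_exp I g"
  using assms by (intro integral_mono) auto

lemma coin_exp_pos:
  assumes "finite I" "\<And>x. f x > 0"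
  shows "coin_exp I f > 0"
proof -
  have "\<And>x. f x \<ge> 0" using assms(2) less_imp_le by blast
  moreover have "\<not> (AE x in coins I. f x = 0)"
    using set_pmf_not_empty[of "coins I"] assms(2) by (auto simp: AE_measure_pmf_iff) (metis less_irrefl)
  ultimately show ?thesis
    using integral_nonneg_eq_0_iff_AE[OF integrable_coins[OF assms(1)], of f]
    by (metis (mono_tags, lifting) AE_I2 Bochner_Integration.integral_nonneg less_eq_real_def)
qed

text \<open>Flipping coin \<open>i\<close> merely exchanges the two halves in
  \<open>coin_exp_insert\<close>.\<close>

lemma coin_exp_flip:
  assumes "finite I" "i \<in> I"
  shows "coin_exp I (\<lambda>x. f (flip i x)) = coin_exp I f"
proof -
  obtain J where J: "I = insert i J" "i \<notin> J" using assms(2) by (meson mk_disjoint_insert)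
  with assms(1) have "finite J" by simp
  with J show ?thesis by (simp add: coin_exp_insert flip_def)
qed

text \<open>The log-sum inequality: relative entropy does not increase when densities are replaced
  by their means. It follows by averaging \<open>ln z \<le> z - 1\<close> at
  \<open>z = q x * P / (p x * Q)\<close>, whose linear terms cancel in the mean.\<close>

lemma coin_exp_log_sum:
  assumes "finite I" "\<And>x. p x > 0" "\<And>x. q x > 0"
  shows "coin_exp I p * ln (coin_exp I p / coin_exp I q) \<le> coin_exp I (\<lambda>x. p x * ln (p x / q x))"
proof -
  define P where "P = coin_exp I p"
  define Q where "Q = coin_exp I q"
  have PQ: "P > 0" "Q > 0" unfolding P_def Q_def by (rule coin_exp_pos; use assms in auto)+
  have "p x * ln (P / Q) + p x - q x * (P / Q) \<le> p x * ln (p x / q x)" for x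
  proof -
    have "ln ((q x * P) / (p x * Q)) \<le> (q x * P) / (p x * Q) - 1"
      using PQ assms by (intro ln_le_minus_one) auto
    hence "p x * ln ((q x * P) / (p x * Q)) \<le> p x * ((q x * P) / (p x * Q) - 1)"
      using assms(2)[of x] by (intro mult_left_mono) auto
    also have "\<dots> = q x * (P / Q) - p x" using assms(2)[of x] PQ by (simp add: field_simps)
    also have "ln ((q x * P) / (p x * Q)) = ln (P / Q) - ln (p x / q x)"
      using assms(2,3)[of x] PQ by (simp add: ln_div ln_mult)
    finally show ?thesis by (simp add: algebra_simps)
  qed
  hence "coin_exp I (\<lambda>x. p x * ln (P / Q) + p x - q x * (P / Q)) \<le> coin_exp I (\<lambda>x. p x * ln (p x / q x))"
    by (intro coin_exp_mono assms)
  also have "coin_exp I (\<lambda>x. p x * ln (P / Q) + p x - q x * (P / Q)) = P * ln (P / Q) + P - Q * (P / Q)"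
    using assms(1) by (simp add: P_def Q_def)
  finally show ?thesis using PQ by (simp add: P_def Q_def)
qed

text \<open>After rearranging, this is the inequality of geometric and arithmetic mean. The right
  side equals \<open>(p - q) * (ln p - ln q) / 4\<close>, the form that tensorises.\<close>

lemma two_point_entropy_le:
  fixes p q :: real
  assumes "p > 0" "q > 0"
  shows "(p * ln p + q * ln q) / 2 - (p + q) / 2 * ln ((p + q) / 2) \<le> (p * ln (p / q) + q * ln (q / p)) / 4"
proof -
  have "0 \<le> (p - q)\<^sup>2" by simp
  hence "p * q \<le> ((p + q) / 2)\<^sup>2" by (simp add: power2_eq_square field_simps)
  hence "ln (p * q) \<le> ln (((p + q) / 2)\<^sup>2)" using assms by (subst ln_le_cancel_iff) auto
  hence "(ln p + ln q) / 2 \<le> ln ((p + q) / 2)" using assms by (simp add: ln_mult ln_realpow)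
  hence "(p + q) / 2 * ((ln p + ln q) / 2) \<le> (p + q) / 2 * ln ((p + q) / 2)"
    using assms by (intro mult_left_mono) auto
  thus ?thesis using assms by (simp add: ln_div field_simps)
qed

text \<open>A modified logarithmic Sobolev inequality. Splitting off one coin writes the entropy as
  the average of the two conditional entropies, bounded by induction, plus the entropy of the pair
  of conditional means \<open>M True\<close>, \<open>M False\<close>.\<close>

lemma entropy_coins_le:
  assumes "finite I"
  shows "coin_exp I (\<lambda>x. g x * exp (g x)) - coin_exp I (\<lambda>x. exp (g x)) * ln (coin_exp I (\<lambda>x. exp (g x)))
    \<le> (\<Sum>i\<in>I. coin_exp I (\<lambda>x. (exp (g x) - exp (g (flip i x))) * (g x - g (flip i x)))) / 4"
  using assms
proof (induction I arbitrary: g rule: finite_induct)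
  case empty
  show ?case by (simp add: coins_def)
next
  case (insert i I)
  define gb where "gb = (\<lambda>b x. g (x(i := b)))"
  define M where "M = (\<lambda>b. coin_exp I (\<lambda>x. exp (gb b x)))"
  define D :: "(('a \<Rightarrow> bool) \<Rightarrow> real) \<Rightarrow> 'a \<Rightarrow> ('a \<Rightarrow> bool) \<Rightarrow> real"
    where "D = (\<lambda>g j x. (exp (g x) - exp (g (flip j x))) * (g x - g (flip j x)))"
  have fin: "finite I" by fact
  have Mpos: "M b > 0" for b unfolding M_def by (rule coin_exp_pos) (use fin in auto)
  have IH: "coin_exp I (\<lambda>x. gb b x * exp (gb b x)) - M b * ln (M b) \<le> (\<Sum>j\<in>I. coin_exp I (D (gb b) j)) / 4" for b
    unfolding M_def D_def by (rule insert.IH)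
  have flipj: "flip j (x(i := b)) = (flip j x)(i := b)" if "j \<in> I" for j b x
    using that insert.hyps by (auto simp: flip_def fun_eq_iff)
  have Dj: "coin_exp (insert i I) (D g j) = (coin_exp I (D (gb True) j) + coin_exp I (D (gb False) j)) / 2"
    if "j \<in> I" for j
    unfolding D_def by (subst coin_exp_insert) (use insert.hyps that in \<open>simp_all add: gb_def flipj\<close>)
  \<comment> \<open>The integrand is symmetric in the two values of coin \<open>i\<close>, so both
    halves agree; it is then written as a symmetrised relative entropy to match the log-sum
    inequality.\<close>
  have Di: "coin_exp (insert i I) (D g i) =
      coin_exp I (\<lambda>x. exp (gb True x) * ln (exp (gb True x) / exp (gb False x)))
      + coin_exp I (\<lambda>x. exp (gb False x) * ln (exp (gb False x) / exp (gb True x)))"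
  proof -
    have "coin_exp (insert i I) (D g i) = coin_exp I (\<lambda>x. (exp (gb True x) - exp (gb False x)) * (gb True x - gb False x))"
    proof -
      have sw: "(exp a - exp b) * (a - b) = (exp b - exp a) * (b - a)" for a b :: real
        by (simp add: algebra_simps)
      have "coin_exp I (\<lambda>x. (exp (gb False x) - exp (gb True x)) * (gb False x - gb True x)) =
          coin_exp I (\<lambda>x. (exp (gb True x) - exp (gb False x)) * (gb True x - gb False x))"
        by (subst sw) (rule refl)
      thus ?thesis
        unfolding D_def by (subst coin_exp_insert) (use insert.hyps in \<open>simp_all add: gb_def flip_def\<close>)
    qed
    also have "\<dots> = coin_exp I (\<lambda>x. exp (gb True x) * ln (exp (gb True x) / exp (gb False x))
       + exp (gb False x) * ln (exp (gb False x) / exp (gb True x)))"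
      by (simp add: ln_div algebra_simps)
    finally show ?thesis using fin by simp
  qed
  have two: "(M True * ln (M True) + M False * ln (M False)) / 2
      - (M True + M False) / 2 * ln ((M True + M False) / 2) \<le> coin_exp (insert i I) (D g i) / 4"
  proof -
    have "M b * ln (M b / M c) \<le> coin_exp I (\<lambda>x. exp (gb b x) * ln (exp (gb b x) / exp (gb c x)))" for b c
      unfolding M_def by (rule coin_exp_log_sum) (use fin in auto)
    from this[of True False] this[of False True]
    have "(M True * ln (M True / M False) + M False * ln (M False / M True)) / 4
        \<le> coin_exp (insert i I) (D g i) / 4"
      unfolding Di by simp
    thus ?thesis using two_point_entropy_le[OF Mpos Mpos, of True False] by linarith
  qed
  have E1: "coin_exp (insert i I) (\<lambda>x. g x * exp (g x)) =
      (coin_exp I (\<lambda>x. gb True x * exp (gb True x)) + coin_exp I (\<lambda>x. gb False x * exp (gb False x))) / 2"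
    by (subst coin_exp_insert) (use insert.hyps in \<open>auto simp: gb_def\<close>)
  have E2: "coin_exp (insert i I) (\<lambda>x. exp (g x)) = (M True + M False) / 2"
    by (subst coin_exp_insert) (use insert.hyps in \<open>auto simp: gb_def M_def\<close>)
  have S: "(\<Sum>j\<in>insert i I. coin_exp (insert i I) (D g j)) =
     coin_exp (insert i I) (D g i) + ((\<Sum>j\<in>I. coin_exp I (D (gb True) j)) + (\<Sum>j\<in>I. coin_exp I (D (gb False) j))) / 2"
    using insert.hyps by (simp add: Dj sum.distrib sum_divide_distrib add_divide_distrib)
  have "coin_exp (insert i I) (\<lambda>x. g x * exp (g x)) -
      coin_exp (insert i I) (\<lambda>x. exp (g x)) * ln (coin_exp (insert i I) (\<lambda>x. exp (g x)))
     \<le> (\<Sum>j\<in>insert i I. coin_exp (insert i I) (D g j)) / 4"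
    unfolding E1 E2 S using IH[of True] IH[of False] two by (simp add: field_simps)
  thus ?case by (simp add: D_def)
qed

section \<open>From the entropy inequality to exponential concentration\<close>

lemma exp_diff_mult_le:
  fixes a b :: real
  shows "(exp a - exp b) * (a - b) \<le> exp a * (max 0 (a - b))\<^sup>2 + exp b * (max 0 (b - a))\<^sup>2"
proof -
  \<comment> \<open>The tangent of \<open>exp\<close> at the larger argument puts the weight there,
    so that later only the drops of the function have to be controlled.\<close>
  have *: "(exp a - exp b) * (a - b) \<le> exp a * (a - b)\<^sup>2" if "a \<ge> b" for a b :: real
  proof -
    have "1 + (b - a) \<le> exp (b - a)" by (rule exp_ge_add_one_self)
    hence "exp a * (1 + (b - a)) \<le> exp a * exp (b - a)" by (intro mult_left_mono) auto
    hence "exp a - exp b \<le> exp a * (a - b)" by (simp add: exp_diff algebra_simps)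
    hence "(exp a - exp b) * (a - b) \<le> (exp a * (a - b)) * (a - b)"
      using that by (intro mult_right_mono) auto
    thus ?thesis by (simp add: power2_eq_square)
  qed
  show ?thesis
  proof (cases "a \<ge> b")
    case True
    thus ?thesis using *[OF True] by (simp add: max_def)
  next
    case False
    thus ?thesis using *[of a b] *[of b a] by (simp add: max_def algebra_simps)
  qed
qed

text \<open>The two terms of \<open>exp_diff_mult_le\<close> are exchanged by the flip, which
  preserves the measure, hence have equal means. This turns the factor \<open>1/4\<close> of the
  entropy inequality into \<open>1/2\<close>, and the remaining sum of squared drops is at most
  \<open>v\<close> at every point.\<close>

lemma coin_entropy_self_bound:
  assumes fin: "finite I" and v: "\<And>x. (\<Sum>i\<in>I. (max 0 (f x - f (flip i x)))\<^sup>2) \<le> v" and "t \<ge> 0"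
  shows "coin_exp I (\<lambda>x. (t * f x) * exp (t * f x))
    - coin_exp I (\<lambda>x. exp (t * f x)) * ln (coin_exp I (\<lambda>x. exp (t * f x)))
    \<le> t\<^sup>2 * v / 2 * coin_exp I (\<lambda>x. exp (t * f x))"
proof -
  define g where "g = (\<lambda>x. t * f x)"
  have flip2: "flip i (flip i x) = x" for i and x :: "'a \<Rightarrow> bool" by (simp add: flip_def)
  have maxt: "max 0 (g x - g y) = t * max 0 (f x - f y)" for x y
    using \<open>t \<ge> 0\<close> by (simp add: g_def max_mult_distrib_left right_diff_distrib)
  have i: "coin_exp I (\<lambda>x. (exp (g x) - exp (g (flip i x))) * (g x - g (flip i x)))
      \<le> 2 * coin_exp I (\<lambda>x. exp (g x) * (max 0 (g x - g (flip i x)))\<^sup>2)" if "i \<in> I" for i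
  proof -
    define F where "F = (\<lambda>x. exp (g x) * (max 0 (g x - g (flip i x)))\<^sup>2)"
    have "coin_exp I (\<lambda>x. (exp (g x) - exp (g (flip i x))) * (g x - g (flip i x)))
      \<le> coin_exp I (\<lambda>x. F x + F (flip i x))"
      unfolding F_def flip2 by (intro coin_exp_mono fin exp_diff_mult_le)
    also have "\<dots> = coin_exp I F + coin_exp I (\<lambda>x. F (flip i x))" using fin by simp
    also have "\<dots> = 2 * coin_exp I F" using coin_exp_flip[OF fin that, of F] by simp
    finally show ?thesis unfolding F_def .
  qed
  have "coin_exp I (\<lambda>x. g x * exp (g x)) - coin_exp I (\<lambda>x. exp (g x)) * ln (coin_exp I (\<lambda>x. exp (g x)))
    \<le> (\<Sum>i\<in>I. coin_exp I (\<lambda>x. (exp (g x) - exp (g (flip i x))) * (g x - g (flip i x)))) / 4"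
    by (rule entropy_coins_le[OF fin])
  also have "\<dots> \<le> (\<Sum>i\<in>I. 2 * coin_exp I (\<lambda>x. exp (g x) * (max 0 (g x - g (flip i x)))\<^sup>2)) / 4"
    by (intro divide_right_mono sum_mono i) auto
  also have "\<dots> = coin_exp I (\<lambda>x. \<Sum>i\<in>I. exp (g x) * (max 0 (g x - g (flip i x)))\<^sup>2) / 2"
    by (subst Bochner_Integration.integral_sum) (use fin in \<open>simp_all add: sum_distrib_left[symmetric]\<close>)
  also have "(\<lambda>x. \<Sum>i\<in>I. exp (g x) * (max 0 (g x - g (flip i x)))\<^sup>2)
      = (\<lambda>x. t\<^sup>2 * exp (g x) * (\<Sum>i\<in>I. (max 0 (f x - f (flip i x)))\<^sup>2))"
    by (simp add: maxt power_mult_distrib sum_distrib_left mult_ac)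
  also have "coin_exp I \<dots> / 2 \<le> coin_exp I (\<lambda>x. t\<^sup>2 * exp (g x) * v) / 2"
    by (intro divide_right_mono coin_exp_mono fin mult_left_mono v) auto
  finally show ?thesis using fin by (simp add: g_def mult_ac)
qed

text \<open>Herbst's argument: the entropy bound says that \<open>ln (E (exp (t f))) / t\<close> has derivative
  at most \<open>v / 2\<close>, and its limit at \<open>0\<close> is \<open>E f\<close>.\<close>

lemma coin_mgf_le:
  assumes fin: "finite I" and v: "\<And>x. (\<Sum>i\<in>I. (max 0 (f x - f (flip i x)))\<^sup>2) \<le> v" and "t > 0"
  shows "coin_exp I (\<lambda>x. exp (t * f x)) \<le> exp (t * coin_exp I f + t\<^sup>2 * v / 2)"
proof -
  define F where "F = (\<lambda>s. coin_exp I (\<lambda>x. exp (s * f x)))"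
  define F' where "F' = (\<lambda>s. coin_exp I (\<lambda>x. f x * exp (s * f x)))"
  note finS = finite_set_coins[OF fin]
  have Fpos: "F s > 0" for s unfolding F_def by (rule coin_exp_pos) (use fin in auto)
  have F0: "F 0 = 1" "F' 0 = coin_exp I f" unfolding F_def F'_def by simp_all
  \<comment> \<open>The coins have finite support, so the expectation is a finite sum and is
    differentiated term by term.\<close>
  have dF: "(F has_real_derivative F' s) (at s)" for s
    unfolding F_def F'_def integral_measure_pmf[OF finS, of _, simplified]
    by (auto simp: integral_measure_pmf[OF finS] intro!: derivative_eq_intros sum.cong)
  have dlnF: "((\<lambda>s. ln (F s)) has_real_derivative F' s / F s) (at s)" for s
    using dF[of s] Fpos[of s] by (auto intro!: derivative_eq_intros)
  have ent: "s * F' s - F s * ln (F s) \<le> s\<^sup>2 * v / 2 * F s" if "s \<ge> 0" for s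
    using coin_entropy_self_bound[OF fin v that] fin unfolding F_def F'_def by (simp add: mult.assoc)
  define H where "H = (\<lambda>s. ln (F s) / s - s * v / 2)"
  have dH: "(H has_real_derivative (F' s / F s * s - ln (F s)) / (s * s) - v / 2) (at s)" if "s > 0" for s
  proof -
    have "((\<lambda>s. ln (F s) / s) has_real_derivative (F' s / F s * s - ln (F s) * 1) / (s * s)) (at s)"
      by (rule DERIV_divide[OF dlnF DERIV_ident]) (use that in auto)
    moreover have "((\<lambda>s. s * v / 2) has_real_derivative v / 2) (at s)"
      by (auto intro!: derivative_eq_intros)
    ultimately show ?thesis unfolding H_def by (auto dest: DERIV_diff)
  qed
  have dH0: "(F' s / F s * s - ln (F s)) / (s * s) - v / 2 \<le> 0" if "s > 0" for s
    using ent[of s] that Fpos[of s] by (simp add: field_simps power2_eq_square)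
  have mono: "H t \<le> H s" if "0 < s" "s \<le> t" for s
  proof (rule DERIV_nonpos_imp_nonincreasing[OF that(2)])
    fix y assume "s \<le> y" "y \<le> t"
    with that show "\<exists>d. (H has_real_derivative d) (at y) \<and> d \<le> 0" using dH[of y] dH0[of y] by auto
  qed
  \<comment> \<open>As \<open>F 0 = 1\<close>, the quotient \<open>ln (F s) / s\<close> is the
    difference quotient of \<open>ln F\<close> at \<open>0\<close>, so its limit is the derivative
    \<open>F' 0 / F 0\<close>.\<close>
  have "((\<lambda>h. (ln (F (0 + h)) - ln (F 0)) / h) \<longlongrightarrow> F' 0 / F 0) (at 0)"
    using dlnF[of 0] by (simp add: DERIV_def)
  hence "((\<lambda>s. ln (F s) / s) \<longlongrightarrow> coin_exp I f) (at 0)" by (simp add: F0)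
  hence "((\<lambda>s. ln (F s) / s) \<longlongrightarrow> coin_exp I f) (at_right 0)"
    by (simp only: filterlim_at_split)
  hence "(H \<longlongrightarrow> coin_exp I f - 0 * v / 2) (at_right 0)"
    unfolding H_def by (intro tendsto_intros) auto
  moreover have "eventually (\<lambda>s. H t \<le> H s) (at_right 0)"
    using \<open>t > 0\<close> mono by (intro eventually_at_rightI[of 0 t]) auto
  ultimately have "H t \<le> coin_exp I f"
    using tendsto_lowerbound[of H "coin_exp I f" "at_right 0" "H t"] by simp
  hence "ln (F t) \<le> t * coin_exp I f + t\<^sup>2 * v / 2"
    using \<open>t > 0\<close> by (simp add: H_def field_simps power2_eq_square)
  hence "F t \<le> exp (t * coin_exp I f + t\<^sup>2 * v / 2)" using Fpos[of t] by (metis exp_le_cancel_iff exp_ln)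
  thus ?thesis by (simp add: F_def)
qed

text \<open>Chernoff's bound with \<open>t = \<epsilon> / v\<close>, which minimises the exponent
  \<open>t\<^sup>2 * v / 2 - t * \<epsilon>\<close>. For \<open>\<epsilon> = 0\<close> the right
  side is \<open>1\<close>.\<close>

lemma coin_concentration:
  assumes fin: "finite I" and v: "\<And>x. (\<Sum>i\<in>I. (max 0 (f x - f (flip i x)))\<^sup>2) \<le> v"
    and "v > 0" "\<epsilon> \<ge> 0"
  shows "measure_pmf.prob (coins I) {x. f x \<ge> coin_exp I f + \<epsilon>} \<le> exp (- \<epsilon>\<^sup>2 / (2 * v))"
proof (cases "\<epsilon> = 0")
  case False
  define t where "t = \<epsilon> / v"
  have t: "t > 0" using False assms by (simp add: t_def)
  let ?m = "coin_exp I f"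
  have "measure_pmf.prob (coins I) {x. f x \<ge> ?m + \<epsilon>} = coin_exp I (indicator {x. f x \<ge> ?m + \<epsilon>})"
    by simp
  also have "\<dots> \<le> coin_exp I (\<lambda>x. exp (- t * (?m + \<epsilon>)) * exp (t * f x))"
  proof (intro coin_exp_mono fin)
    fix x
    show "indicator {x. f x \<ge> ?m + \<epsilon>} x \<le> exp (- t * (?m + \<epsilon>)) * exp (t * f x)"
    proof (cases "f x \<ge> ?m + \<epsilon>")
      case True
      hence "t * (?m + \<epsilon>) \<le> t * f x" using t by (intro mult_left_mono) auto
      thus ?thesis by (auto simp: indicator_def exp_add[symmetric])
    qed (auto simp: indicator_def)
  qed
  also have "\<dots> = exp (- t * (?m + \<epsilon>)) * coin_exp I (\<lambda>x. exp (t * f x))" using fin by simp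
  also have "\<dots> \<le> exp (- t * (?m + \<epsilon>)) * exp (t * ?m + t\<^sup>2 * v / 2)"
    by (intro mult_left_mono coin_mgf_le fin v t) auto
  also have "\<dots> = exp (- \<epsilon>\<^sup>2 / (2 * v))"
    unfolding exp_add[symmetric] t_def using \<open>v > 0\<close> by (simp add: field_simps power2_eq_square)
  finally show ?thesis .
qed simp

section \<open>Gibbs' inequality for Gaussian vectors\<close>

text \<open>A product measure is determined by its values on boxes, and on a box the integral of the
  product density factorises.\<close>

lemma PiM_density:
  assumes fin: "finite I" and sf: "\<And>i. sigma_finite_measure (M i)"
    and sfd: "\<And>i. sigma_finite_measure (density (M i) (f i))"
    and meas: "\<And>i. f i \<in> borel_measurable (M i)"
  shows "PiM I (\<lambda>i. density (M i) (f i)) = density (PiM I M) (\<lambda>x. \<Prod>i\<in>I. f i (x i))"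
proof -
  interpret D: product_sigma_finite "\<lambda>i. density (M i) (f i)" by (simp add: product_sigma_finite_def sfd)
  interpret P: product_sigma_finite M by (simp add: product_sigma_finite_def sf)
  note meas[measurable]
  have "density (PiM I M) (\<lambda>x. \<Prod>i\<in>I. f i (x i)) = PiM I (\<lambda>i. density (M i) (f i))"
  proof (rule D.PiM_eqI[OF fin])
    show "sets (density (PiM I M) (\<lambda>x. \<Prod>i\<in>I. f i (x i))) = sets (PiM I (\<lambda>i. density (M i) (f i)))"
      by (simp cong: sets_PiM_cong)
    fix A assume "\<And>i. i \<in> I \<Longrightarrow> A i \<in> sets (density (M i) (f i))"
    hence A[measurable]: "\<And>i. i \<in> I \<Longrightarrow> A i \<in> sets (M i)" by simp
    have PA: "Pi\<^sub>E I A \<in> sets (PiM I M)" using fin A by (intro sets_PiM_I_finite) auto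
    have m: "(\<lambda>x. \<Prod>i\<in>I. f i (x i)) \<in> borel_measurable (PiM I M)"
      by measurable
    have "emeasure (density (PiM I M) (\<lambda>x. \<Prod>i\<in>I. f i (x i))) (Pi\<^sub>E I A)
        = (\<integral>\<^sup>+ x. (\<Prod>i\<in>I. f i (x i)) * indicator (Pi\<^sub>E I A) x \<partial>PiM I M)"
      by (rule emeasure_density[OF m PA])
    also have "\<dots> = (\<integral>\<^sup>+ x. (\<Prod>i\<in>I. f i (x i) * indicator (A i) (x i)) \<partial>PiM I M)"
    proof (rule nn_integral_cong)
      fix x assume "x \<in> space (PiM I M)"
      hence x: "x \<in> extensional I" by (auto simp: space_PiM PiE_def)
      have "(\<Prod>i\<in>I. indicator (A i) (x i)) = (indicator (Pi\<^sub>E I A) x :: ennreal)"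
      proof (cases "\<forall>i\<in>I. x i \<in> A i")
        case True
        thus ?thesis using x by (auto simp: indicator_def PiE_def)
      next
        case False
        thus ?thesis using fin by (auto simp: indicator_def PiE_def prod_zero_iff)
      qed
      thus "(\<Prod>i\<in>I. f i (x i)) * indicator (Pi\<^sub>E I A) x = (\<Prod>i\<in>I. f i (x i) * indicator (A i) (x i))"
        by (simp add: prod.distrib)
    qed
    also have "\<dots> = (\<Prod>i\<in>I. \<integral>\<^sup>+ x. f i x * indicator (A i) x \<partial>M i)"
      by (rule P.product_nn_integral_prod[OF fin]) measurable
    also have "\<dots> = (\<Prod>i\<in>I. emeasure (density (M i) (f i)) (A i))"
      by (intro prod.cong refl emeasure_density[symmetric] meas A)
    finally show "emeasure (density (PiM I M) (\<lambda>x. \<Prod>i\<in>I. f i (x i))) (Pi\<^sub>E I A) =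
      (\<Prod>i\<in>I. emeasure (density (M i) (f i)) (A i))" .
  qed
  thus ?thesis by simp
qed

text \<open>The product formula for integrals, with the constant factor \<open>1\<close> in all
  other coordinates.\<close>

lemma integral_PiM_component:
  fixes f :: "'b \<Rightarrow> real"
  assumes "\<And>i. prob_space (M i)" "finite I" "i \<in> I" "integrable (M i) f"
  shows "integrable (PiM I M) (\<lambda>x. f (x i))" "(\<integral>x. f (x i) \<partial>PiM I M) = (\<integral>y. f y \<partial>M i)"
proof -
  interpret product_sigma_finite M
    by (simp add: product_sigma_finite_def prob_space_imp_sigma_finite assms(1))
  define F where "F = (\<lambda>k. if k = i then f else (\<lambda>_. 1))"
  have F: "integrable (M k) (F k)" for k
    using assms(4) prob_space.finite_measure[OF assms(1)] by (auto simp: F_def finite_measure.integrable_const)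
  have eq: "(\<Prod>k\<in>I. F k (x k)) = f (x i)" for x
    using assms(2,3) by (subst prod.remove[of _ i]) (auto simp: F_def intro!: prod.neutral)
  have "(\<Prod>k\<in>I. integral\<^sup>L (M k) (F k)) = integral\<^sup>L (M i) f"
    using assms(2,3) prob_space.prob_space[OF assms(1)]
    by (subst prod.remove[of _ i]) (auto simp: F_def intro!: prod.neutral)
  with product_integral_prod[OF assms(2) F] product_integrable_prod[OF assms(2) F]
  show "integrable (PiM I M) (\<lambda>x. f (x i))" "(\<integral>x. f (x i) \<partial>PiM I M) = (\<integral>y. f y \<partial>M i)"
    unfolding eq by simp_all
qed

lemma integral_PiM_pair:
  fixes f g :: "'b \<Rightarrow> real"
  assumes "\<And>i. prob_space (M i)" "finite I" "i \<in> I" "j \<in> I" "i \<noteq> j" "integrable (M i) f" "integrable (M j) g"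
  shows "integrable (PiM I M) (\<lambda>x. f (x i) * g (x j))"
    "(\<integral>x. f (x i) * g (x j) \<partial>PiM I M) = (\<integral>y. f y \<partial>M i) * (\<integral>y. g y \<partial>M j)"
proof -
  interpret product_sigma_finite M
    by (simp add: product_sigma_finite_def prob_space_imp_sigma_finite assms(1))
  define F where "F = (\<lambda>k. if k = i then f else if k = j then g else (\<lambda>_. 1))"
  have F: "integrable (M k) (F k)" for k
    using assms(6,7) prob_space.finite_measure[OF assms(1)] by (auto simp: F_def finite_measure.integrable_const)
  have eq: "(\<Prod>k\<in>I. F k (x k)) = f (x i) * g (x j)" for x
    using assms(2-5)
    by (subst prod.remove[of _ i], simp, simp, subst prod.remove[of _ j]) (auto simp: F_def intro!: prod.neutral)
  have "(\<Prod>k\<in>I. integral\<^sup>L (M k) (F k)) = integral\<^sup>L (M i) f * integral\<^sup>L (M j) g"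
    using assms(2-5) prob_space.prob_space[OF assms(1)]
    by (subst prod.remove[of _ i], simp, simp, subst prod.remove[of _ j]) (auto simp: F_def intro!: prod.neutral)
  with product_integral_prod[OF assms(2) F] product_integrable_prod[OF assms(2) F]
  show "integrable (PiM I M) (\<lambda>x. f (x i) * g (x j))"
    "(\<integral>x. f (x i) * g (x j) \<partial>PiM I M) = (\<integral>y. f y \<partial>M i) * (\<integral>y. g y \<partial>M j)"
    unfolding eq by simp_all
qed

section \<open>Gaussian measures on the line and their relative entropy\<close>

definition normal_measure :: "real \<Rightarrow> real \<Rightarrow> real measure" where
  "normal_measure m \<tau> = density lborel (\<lambda>x. ennreal (normal_density m \<tau> x))"

lemma prob_space_normal_measure: "\<tau> > 0 \<Longrightarrow> prob_space (normal_measure m \<tau>)"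
  unfolding normal_measure_def by (rule prob_space_normal_density)

lemma sets_normal_measure [measurable_cong, simp]: "sets (normal_measure m \<tau>) = sets borel"
  by (simp add: normal_measure_def)

lemma normal_measure_moments:
  assumes "\<tau> > 0"
  shows "integrable (normal_measure m \<tau>) (\<lambda>x. (x - m) ^ k)"
    "(\<integral>x. (x - m) \<partial>normal_measure m \<tau>) = 0"
    "(\<integral>x. (x - m)\<^sup>2 \<partial>normal_measure m \<tau>) = \<tau>\<^sup>2"
proof -
  show "integrable (normal_measure m \<tau>) (\<lambda>x. (x - m) ^ k)"
    unfolding normal_measure_def using integrable_normal_moment[OF assms, of m k]
    by (subst integrable_density) auto
  show "(\<integral>x. (x - m) \<partial>normal_measure m \<tau>) = 0"
    unfolding normal_measure_def using integral_normal_moment_odd[OF assms, of m 0]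
    by (subst integral_density) auto
  show "(\<integral>x. (x - m)\<^sup>2 \<partial>normal_measure m \<tau>) = \<tau>\<^sup>2"
    unfolding normal_measure_def using integral_normal_moment_even[OF assms, of m 1]
    by (subst integral_density) (auto simp: numeral_2_eq_2)
qed

lemma normal_measure_quadratic:
  assumes "\<tau> > 0"
  shows "has_bochner_integral (normal_measure m \<tau>) (\<lambda>x. a * (x - m)\<^sup>2 + b * (x - m) + c) (a * \<tau>\<^sup>2 + c)"
proof -
  interpret prob_space "normal_measure m \<tau>" by (rule prob_space_normal_measure[OF assms])
  have *: "integrable (normal_measure m \<tau>) (\<lambda>x. x - m)" "integrable (normal_measure m \<tau>) (\<lambda>x. (x - m)\<^sup>2)"
    using normal_measure_moments(1)[OF assms, of m 1] normal_measure_moments(1)[OF assms, of m 2] by simp_all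
  show ?thesis
    unfolding has_bochner_integral_iff using * normal_measure_moments(2,3)[OF assms, of m] prob_space
    by simp
qed

lemma normal_measure_mean_square:
  assumes "\<tau> > 0"
  shows "has_bochner_integral (normal_measure m \<tau>) (\<lambda>x. x) m"
    "has_bochner_integral (normal_measure m \<tau>) (\<lambda>x. x\<^sup>2) (m\<^sup>2 + \<tau>\<^sup>2)"
  using normal_measure_quadratic[OF assms, of m 0 1 m] normal_measure_quadratic[OF assms, of m 1 "2*m" "m\<^sup>2"]
  by (simp_all add: algebra_simps power2_eq_square)

text \<open>The log-likelihood ratio of the posterior \<open>N(m, \<tau>\<^sup>2)\<close> to the
  prior \<open>N(\<mu>, \<kappa>\<^sup>2)\<close>.\<close>

definition normal_log_ratio :: "real \<Rightarrow> real \<Rightarrow> real \<Rightarrow> real \<Rightarrow> real \<Rightarrow> real" where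
  "normal_log_ratio m \<tau> \<mu> \<kappa> x = ln (\<kappa> / \<tau>) - (x - m)\<^sup>2 / (2 * \<tau>\<^sup>2) + (x - \<mu>)\<^sup>2 / (2 * \<kappa>\<^sup>2)"

lemma normal_log_ratio_measurable [measurable]: "normal_log_ratio m \<tau> \<mu> \<kappa> \<in> borel_measurable borel"
  unfolding normal_log_ratio_def[abs_def] by measurable

lemma normal_density_change:
  assumes "\<tau> > 0" "\<kappa> > 0"
  shows "normal_density m \<tau> x * exp (- normal_log_ratio m \<tau> \<mu> \<kappa> x) = normal_density \<mu> \<kappa> x"
proof -
  have "exp (- normal_log_ratio m \<tau> \<mu> \<kappa> x) = exp (ln (\<tau> / \<kappa>)) * exp ((x - m)\<^sup>2 / (2 * \<tau>\<^sup>2)) * exp (- (x - \<mu>)\<^sup>2 / (2 * \<kappa>\<^sup>2))"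
    unfolding exp_add[symmetric] using assms by (simp add: normal_log_ratio_def ln_div)
  thus ?thesis using assms
    by (simp add: normal_density_def exp_minus real_sqrt_mult field_simps)
qed

lemma normal_measure_change:
  assumes "\<tau> > 0" "\<kappa> > 0"
  shows "normal_measure \<mu> \<kappa> = density (normal_measure m \<tau>) (\<lambda>x. ennreal (exp (- normal_log_ratio m \<tau> \<mu> \<kappa> x)))"
  unfolding normal_measure_def
  by (subst density_density_eq)
    (auto simp: ennreal_mult[symmetric] normal_density_change[OF assms])

text \<open>The mean of the log-likelihood ratio under the posterior is the relative entropy of the
  two Gaussians.\<close>

lemma normal_log_ratio_integral:
  assumes "\<tau> > 0" "\<kappa> > 0"
  shows "has_bochner_integral (normal_measure m \<tau>) (normal_log_ratio m \<tau> \<mu> \<kappa>)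
    (ln (\<kappa> / \<tau>) - 1 / 2 + (\<tau>\<^sup>2 + (m - \<mu>)\<^sup>2) / (2 * \<kappa>\<^sup>2))"
proof -
  \<comment> \<open>Coefficients of the log-likelihood ratio expanded around \<open>m\<close>, where
    the linear term has mean zero.\<close>
  let ?a = "1 / (2 * \<kappa>\<^sup>2) - 1 / (2 * \<tau>\<^sup>2)" and ?b = "(m - \<mu>) / \<kappa>\<^sup>2" and ?c = "ln (\<kappa> / \<tau>) + (m - \<mu>)\<^sup>2 / (2 * \<kappa>\<^sup>2)"
  have eq1: "normal_log_ratio m \<tau> \<mu> \<kappa> = (\<lambda>x. ?a * (x - m)\<^sup>2 + ?b * (x - m) + ?c)"
    using assms by (auto simp: normal_log_ratio_def fun_eq_iff field_simps power2_eq_square)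
  have eq2: "?a * \<tau>\<^sup>2 + ?c = ln (\<kappa> / \<tau>) - 1 / 2 + (\<tau>\<^sup>2 + (m - \<mu>)\<^sup>2) / (2 * \<kappa>\<^sup>2)"
  proof -
    have "?a * \<tau>\<^sup>2 = \<tau>\<^sup>2 / (2 * \<kappa>\<^sup>2) - 1 / 2" using assms by (simp add: left_diff_distrib)
    thus ?thesis by (simp add: add_divide_distrib)
  qed
  show ?thesis using normal_measure_quadratic[OF assms(1), of m ?a ?b ?c] unfolding eq1 eq2 .
qed

section \<open>Gaussian vectors with independent coordinates and a change of measure\<close>

definition normal_vector :: "nat \<Rightarrow> (nat \<Rightarrow> real) \<Rightarrow> real \<Rightarrow> (nat \<Rightarrow> real) measure" where
  "normal_vector n m \<tau> = PiM {..<n} (\<lambda>i. normal_measure (m i) \<tau>)"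

lemma prob_space_normal_vector: "\<tau> > 0 \<Longrightarrow> prob_space (normal_vector n m \<tau>)"
  unfolding normal_vector_def by (intro prob_space_PiM prob_space_normal_measure)

lemma sets_normal_vector [measurable_cong]: "sets (normal_vector n m \<tau>) = sets (PiM {..<n} (\<lambda>_. borel))"
  unfolding normal_vector_def by (intro sets_PiM_cong) auto

lemma normal_vector_change:
  assumes "\<tau> > 0" "\<kappa> > 0"
  shows "normal_vector n \<mu> \<kappa> = density (normal_vector n m \<tau>)
    (\<lambda>x. ennreal (exp (- (\<Sum>i<n. normal_log_ratio (m i) \<tau> (\<mu> i) \<kappa> (x i)))))"
proof -
  have "normal_vector n \<mu> \<kappa> = PiM {..<n} (\<lambda>i. density (normal_measure (m i) \<tau>)
      (\<lambda>x. ennreal (exp (- normal_log_ratio (m i) \<tau> (\<mu> i) \<kappa> x))))"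
    unfolding normal_vector_def by (simp add: normal_measure_change[OF assms, symmetric])
  also have "\<dots> = density (normal_vector n m \<tau>)
      (\<lambda>x. \<Prod>i<n. ennreal (exp (- normal_log_ratio (m i) \<tau> (\<mu> i) \<kappa> (x i))))"
    unfolding normal_vector_def
    by (rule PiM_density)
      (auto simp: normal_measure_change[OF assms, symmetric]
        intro!: prob_space_imp_sigma_finite prob_space_normal_measure assms)
  also have "(\<lambda>x. \<Prod>i<n. ennreal (exp (- normal_log_ratio (m i) \<tau> (\<mu> i) \<kappa> (x i))))
      = (\<lambda>x. ennreal (exp (- (\<Sum>i<n. normal_log_ratio (m i) \<tau> (\<mu> i) \<kappa> (x i)))))"
    by (simp add: prod_ennreal exp_sum sum_negf[symmetric])
  finally show ?thesis .
qed

text \<open>Under the posterior, the integral on the right is the mean of \<open>exp (h - L)\<close>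
  with \<open>L\<close> the log-likelihood ratio, and Jensen's inequality applies. The mean of
  \<open>L\<close> is the relative entropy, summed over coordinates; the upper bound
  \<open>B\<close> makes \<open>exp h\<close> integrable.\<close>

lemma normal_vector_gibbs:
  assumes "\<tau> > 0" "\<kappa> > 0"
    and h[measurable]: "h \<in> borel_measurable (PiM {..<n} (\<lambda>_. borel))"
    and hi: "integrable (normal_vector n m \<tau>) h" and hB: "\<And>x. h x \<le> B"
  shows "exp ((\<integral>x. h x \<partial>normal_vector n m \<tau>)
      - (\<Sum>i<n. ln (\<kappa> / \<tau>) - 1 / 2 + (\<tau>\<^sup>2 + (m i - \<mu> i)\<^sup>2) / (2 * \<kappa>\<^sup>2)))
    \<le> (\<integral>x. exp (h x) \<partial>normal_vector n \<mu> \<kappa>)"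
proof -
  interpret R: prob_space "normal_vector n m \<tau>" by (rule prob_space_normal_vector[OF assms(1)])
  interpret P: prob_space "normal_vector n \<mu> \<kappa>" by (rule prob_space_normal_vector[OF assms(2)])
  define L where "L = (\<lambda>x. \<Sum>i<n. normal_log_ratio (m i) \<tau> (\<mu> i) \<kappa> (x i))"
  have Lm[measurable]: "L \<in> borel_measurable (PiM {..<n} (\<lambda>_. borel))"
    unfolding L_def normal_log_ratio_def by measurable
  have Li1: "integrable (normal_vector n m \<tau>) (\<lambda>x. normal_log_ratio (m i) \<tau> (\<mu> i) \<kappa> (x i))"
    "(\<integral>x. normal_log_ratio (m i) \<tau> (\<mu> i) \<kappa> (x i) \<partial>normal_vector n m \<tau>)
      = ln (\<kappa> / \<tau>) - 1 / 2 + (\<tau>\<^sup>2 + (m i - \<mu> i)\<^sup>2) / (2 * \<kappa>\<^sup>2)" if "i < n" for i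
  proof -
    have *: "integrable (normal_measure (m i) \<tau>) (normal_log_ratio (m i) \<tau> (\<mu> i) \<kappa>)"
      "integral\<^sup>L (normal_measure (m i) \<tau>) (normal_log_ratio (m i) \<tau> (\<mu> i) \<kappa>)
        = ln (\<kappa> / \<tau>) - 1 / 2 + (\<tau>\<^sup>2 + (m i - \<mu> i)\<^sup>2) / (2 * \<kappa>\<^sup>2)"
      using normal_log_ratio_integral[OF assms(1,2), of "m i" "\<mu> i"] by (auto simp: has_bochner_integral_iff)
    note I = integral_PiM_component[where M = "\<lambda>i. normal_measure (m i) \<tau>" and I = "{..<n}" and i = i,
        OF prob_space_normal_measure[OF assms(1)] _ _ *(1)]
    show "integrable (normal_vector n m \<tau>) (\<lambda>x. normal_log_ratio (m i) \<tau> (\<mu> i) \<kappa> (x i))"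
      unfolding normal_vector_def by (rule I(1)) (use that in auto)
    show "(\<integral>x. normal_log_ratio (m i) \<tau> (\<mu> i) \<kappa> (x i) \<partial>normal_vector n m \<tau>)
      = ln (\<kappa> / \<tau>) - 1 / 2 + (\<tau>\<^sup>2 + (m i - \<mu> i)\<^sup>2) / (2 * \<kappa>\<^sup>2)"
      unfolding normal_vector_def *(2)[symmetric] by (rule I(2)) (use that in auto)
  qed
  have Li: "integrable (normal_vector n m \<tau>) L"
    unfolding L_def by (intro Bochner_Integration.integrable_sum Li1) auto
  have KL: "(\<integral>x. L x \<partial>normal_vector n m \<tau>) = (\<Sum>i<n. ln (\<kappa> / \<tau>) - 1 / 2 + (\<tau>\<^sup>2 + (m i - \<mu> i)\<^sup>2) / (2 * \<kappa>\<^sup>2))"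
    unfolding L_def by (subst Bochner_Integration.integral_sum) (auto simp: Li1)
  define c where "c = (\<integral>x. h x - L x \<partial>normal_vector n m \<tau>)"
  have ei: "integrable (normal_vector n \<mu> \<kappa>) (\<lambda>x. exp (h x))"
    by (rule P.integrable_const_bound[where B = "exp B"]) (use hB in auto)
  have ch: "normal_vector n \<mu> \<kappa> = density (normal_vector n m \<tau>) (\<lambda>x. ennreal (exp (- L x)))"
    unfolding L_def by (rule normal_vector_change[OF assms(1,2)])
  have ei': "integrable (normal_vector n m \<tau>) (\<lambda>x. exp (- L x) * exp (h x))"
    using ei unfolding ch by (subst (asm) integrable_density) auto
  \<comment> \<open>Jensen's inequality by hand: \<open>exp\<close> lies above its tangent at the
    mean \<open>c\<close>.\<close>
  have "exp c = (\<integral>x. exp c * (1 + ((h x - L x) - c)) \<partial>normal_vector n m \<tau>)"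
    using hi Li R.prob_space by (simp add: c_def)
  also have "\<dots> \<le> (\<integral>x. exp (- L x) * exp (h x) \<partial>normal_vector n m \<tau>)"
  proof (rule integral_mono[OF _ ei'])
    show "integrable (normal_vector n m \<tau>) (\<lambda>x. exp c * (1 + ((h x - L x) - c)))"
      using hi Li by simp
    fix x
    have "exp c * (1 + ((h x - L x) - c)) \<le> exp c * exp ((h x - L x) - c)"
      by (intro mult_left_mono exp_ge_add_one_self) auto
    also have "\<dots> = exp (- L x) * exp (h x)" by (simp flip: exp_add)
    finally show "exp c * (1 + ((h x - L x) - c)) \<le> exp (- L x) * exp (h x)" .
  qed
  also have "\<dots> = (\<integral>x. exp (h x) \<partial>normal_vector n \<mu> \<kappa>)"
    unfolding ch by (subst integral_density) auto
  finally show ?thesis using hi Li by (simp add: c_def KL)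
qed

section \<open>Random quadratic forms smoothed by a Gaussian vector\<close>

definition index_pairs :: "nat \<Rightarrow> (nat \<times> nat) set" where
  "index_pairs n = {(i, j). i < j \<and> j < n}"

lemma finite_index_pairs [simp]: "finite (index_pairs n)"
  by (rule finite_subset[of _ "{..<n} \<times> {..<n}"]) (auto simp: index_pairs_def)

text \<open>The square of indices splits into two mirror-image triangles and the diagonal.\<close>

lemma sum_index_pairs_symmetric:
  fixes f :: "nat \<Rightarrow> nat \<Rightarrow> real"
  assumes "\<And>i j. f i j = f j i"
  shows "(\<Sum>i<n. \<Sum>j<n. f i j) = 2 * (\<Sum>(i, j)\<in>index_pairs n. f i j) + (\<Sum>i<n. f i i)"
proof -
  let ?P = "index_pairs n" and ?Q = "(\<lambda>(i, j). (j, i)) ` index_pairs n" and ?D = "(\<lambda>i. (i, i)) ` {..<n}"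
  have "{..<n} \<times> {..<n} = (?P \<union> ?Q) \<union> ?D"
    by (auto simp: index_pairs_def image_iff)
  hence "(\<Sum>i<n. \<Sum>j<n. f i j) = (\<Sum>(i, j)\<in>(?P \<union> ?Q) \<union> ?D. f i j)"
    by (simp add: sum.cartesian_product)
  also have "\<dots> = (\<Sum>(i, j)\<in>?P. f i j) + (\<Sum>(i, j)\<in>?Q. f i j) + (\<Sum>(i, j)\<in>?D. f i j)"
    by (subst sum.union_disjoint; (subst sum.union_disjoint)?)
      (use finite_index_pairs[of n] in \<open>auto simp: index_pairs_def\<close>)
  also have "(\<Sum>(i, j)\<in>?Q. f i j) = (\<Sum>(i, j)\<in>?P. f i j)"
    by (subst sum.reindex) (auto simp: inj_on_def assms intro!: sum.cong)
  also have "(\<Sum>(i, j)\<in>?D. f i j) = (\<Sum>i<n. f i i)"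
    by (subst sum.reindex) (auto simp: inj_on_def)
  finally show ?thesis by simp
qed

text \<open>The subtracted quartic is the logarithm of the sub-Gaussian bound for the moment generating
  function of the random quadratic form.\<close>

definition tilted_form :: "nat \<Rightarrow> real \<Rightarrow> (nat \<times> nat \<Rightarrow> real) \<Rightarrow> (nat \<Rightarrow> real) \<Rightarrow> real" where
  "tilted_form n t s x = (\<Sum>(i, j)\<in>index_pairs n. 2 * t * s (i, j) * (x i * x j) - 2 * t\<^sup>2 * ((x i)\<^sup>2 * (x j)\<^sup>2))"

lemma tilted_form_measurable [measurable]:
  "tilted_form n t s \<in> borel_measurable (PiM {..<n} (\<lambda>_. borel))"
  unfolding tilted_form_def case_prod_beta
  by (intro borel_measurable_sum borel_measurable_diff borel_measurable_times borel_measurable_const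
      borel_measurable_power measurable_component_singleton) (auto simp: index_pairs_def)

text \<open>Completing the square in each pair bounds the form independently of \<open>x\<close>;
  this makes its exponential integrable.\<close>

lemma tilted_form_le: "tilted_form n t s x \<le> (\<Sum>p\<in>index_pairs n. (s p)\<^sup>2 / 2)"
  unfolding tilted_form_def case_prod_beta
proof (rule sum_mono)
  fix p
  let ?y = "x (fst p) * x (snd p)"
  have "0 \<le> (s p - 2 * t * ?y)\<^sup>2 / 2" by simp
  thus "2 * t * s (fst p, snd p) * (x (fst p) * x (snd p)) - 2 * t\<^sup>2 * ((x (fst p))\<^sup>2 * (x (snd p))\<^sup>2) \<le> (s p)\<^sup>2 / 2"
    by (simp add: power2_eq_square field_simps)
qed

text \<open>The two indices of a pair differ, so by independence each mean is a product of first or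
  of second moments.\<close>

lemma tilted_form_integral:
  assumes "\<tau> > 0"
  shows "has_bochner_integral (normal_vector n m \<tau>) (tilted_form n t s)
    (\<Sum>(i, j)\<in>index_pairs n. 2 * t * s (i, j) * (m i * m j) - 2 * t\<^sup>2 * (((m i)\<^sup>2 + \<tau>\<^sup>2) * ((m j)\<^sup>2 + \<tau>\<^sup>2)))"
  unfolding tilted_form_def[abs_def] case_prod_beta
proof (intro has_bochner_integral_sum has_bochner_integral_diff has_bochner_integral_mult_right)
  fix p assume "p \<in> index_pairs n"
  hence p: "fst p \<in> {..<n}" "snd p \<in> {..<n}" "fst p \<noteq> snd p" by (auto simp: index_pairs_def)
  note I = integral_PiM_pair[where M = "\<lambda>i. normal_measure (m i) \<tau>", OF prob_space_normal_measure[OF assms] finite_lessThan p]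
  note ms = normal_measure_mean_square[OF assms, unfolded has_bochner_integral_iff]
  show "has_bochner_integral (normal_vector n m \<tau>) (\<lambda>x. x (fst p) * x (snd p)) (m (fst p) * m (snd p))"
    unfolding normal_vector_def has_bochner_integral_iff
    using I[of "\<lambda>x. x" "\<lambda>x. x"] ms by simp
  show "has_bochner_integral (normal_vector n m \<tau>) (\<lambda>x. (x (fst p))\<^sup>2 * (x (snd p))\<^sup>2)
     (((m (fst p))\<^sup>2 + \<tau>\<^sup>2) * ((m (snd p))\<^sup>2 + \<tau>\<^sup>2))"
    unfolding normal_vector_def has_bochner_integral_iff
    using I[of "\<lambda>x. x\<^sup>2" "\<lambda>x. x\<^sup>2"] ms by simp
qed

text \<open>Gibbs' inequality for the tilted form. Under the posterior the quadratic part has its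
  value at \<open>m\<close> as mean. Adding the nonnegative diagonal bounds the quartic part by the
  square of the total second moment.\<close>

lemma exp_quadratic_form_le_integral:
  assumes "\<tau> > 0" "\<kappa> > 0"
  shows "exp (t * (2 * (\<Sum>(i, j)\<in>index_pairs n. s (i, j) * (m i * m j)))
      - t\<^sup>2 * ((\<Sum>i<n. (m i)\<^sup>2) + n * \<tau>\<^sup>2)\<^sup>2
      - (n * (ln (\<kappa> / \<tau>) - 1 / 2 + \<tau>\<^sup>2 / (2 * \<kappa>\<^sup>2)) + (\<Sum>i<n. (m i - \<mu> i)\<^sup>2) / (2 * \<kappa>\<^sup>2)))
    \<le> (\<integral>x. exp (tilted_form n t s x) \<partial>normal_vector n \<mu> \<kappa>)"
proof -
  define w where "w = (\<lambda>i. (m i)\<^sup>2 + \<tau>\<^sup>2)"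
  have "(\<Sum>i<n. w i)\<^sup>2 = 2 * (\<Sum>(i, j)\<in>index_pairs n. w i * w j) + (\<Sum>i<n. w i * w i)"
    unfolding power2_eq_square sum_product by (rule sum_index_pairs_symmetric) simp
  hence "2 * (\<Sum>(i, j)\<in>index_pairs n. w i * w j) \<le> (\<Sum>i<n. w i)\<^sup>2"
    using sum_nonneg[of "{..<n}" "\<lambda>i. w i * w i"] by simp
  hence A: "t\<^sup>2 * (2 * (\<Sum>(i, j)\<in>index_pairs n. w i * w j)) \<le> t\<^sup>2 * ((\<Sum>i<n. (m i)\<^sup>2) + n * \<tau>\<^sup>2)\<^sup>2"
    by (intro mult_left_mono) (auto simp: w_def sum.distrib)
  have I: "(\<integral>x. tilted_form n t s x \<partial>normal_vector n m \<tau>)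
      = t * (2 * (\<Sum>(i, j)\<in>index_pairs n. s (i, j) * (m i * m j))) - t\<^sup>2 * (2 * (\<Sum>(i, j)\<in>index_pairs n. w i * w j))"
    using tilted_form_integral[OF assms(1), of n m t s]
    by (simp add: has_bochner_integral_iff w_def case_prod_beta sum_subtractf sum_distrib_left mult_ac)
  have gibbs: "exp ((\<integral>x. tilted_form n t s x \<partial>normal_vector n m \<tau>)
      - (\<Sum>i<n. ln (\<kappa> / \<tau>) - 1 / 2 + (\<tau>\<^sup>2 + (m i - \<mu> i)\<^sup>2) / (2 * \<kappa>\<^sup>2)))
    \<le> (\<integral>x. exp (tilted_form n t s x) \<partial>normal_vector n \<mu> \<kappa>)"
    using tilted_form_integral[OF assms(1), of n m t s]
    by (intro normal_vector_gibbs[OF assms _ _ tilted_form_le] tilted_form_measurable)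
      (auto simp: has_bochner_integral_iff)
  have "(\<Sum>i<n. ln (\<kappa> / \<tau>) - 1 / 2 + (\<tau>\<^sup>2 + (m i - \<mu> i)\<^sup>2) / (2 * \<kappa>\<^sup>2))
      = n * (ln (\<kappa> / \<tau>) - 1 / 2 + \<tau>\<^sup>2 / (2 * \<kappa>\<^sup>2)) + (\<Sum>i<n. (m i - \<mu> i)\<^sup>2) / (2 * \<kappa>\<^sup>2)"
    by (simp add: sum.distrib sum_subtractf add_divide_distrib sum_divide_distrib right_diff_distrib distrib_left)
  with gibbs A I show ?thesis by (elim order_trans[rotated]) simp
qed

section \<open>The norm of the skewed adjacency matrix and its concentration\<close>

lemma euclidean_norm_eq_L2_set:
  assumes "x \<in> carrier_vec n"
  shows "euclidean_norm x = L2_set (\<lambda>i. x $ i) {..<n}"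
  using assms by (simp add: euclidean_norm_def L2_set_def scalar_prod_def lessThan_atLeast0 power2_eq_square)

text \<open>Vectors are represented by functions of which only the values below \<open>n\<close>
  matter, so that finite sums replace carrier conditions.\<close>

definition apply_mat :: "nat \<Rightarrow> (nat \<Rightarrow> nat \<Rightarrow> real) \<Rightarrow> (nat \<Rightarrow> real) \<Rightarrow> nat \<Rightarrow> real" where
  "apply_mat n K x i = (\<Sum>j<n. K i j * x j)"

lemma operator_norm_eq_SUP:
  assumes A: "A \<in> carrier_mat n n" and K: "\<And>i j. i < n \<Longrightarrow> j < n \<Longrightarrow> A $$ (i, j) = K i j"
  shows "operator_norm A = (SUP x\<in>{x. L2_set x {..<n} = 1}. L2_set (apply_mat n K x) {..<n})"
proof -
  have mv: "euclidean_norm (A *\<^sub>v x) = L2_set (apply_mat n K (\<lambda>i. x $ i)) {..<n}" if "x \<in> carrier_vec n" for x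
  proof -
    have "A *\<^sub>v x \<in> carrier_vec n" using A that by auto
    hence "euclidean_norm (A *\<^sub>v x) = L2_set (\<lambda>i. (A *\<^sub>v x) $ i) {..<n}" by (rule euclidean_norm_eq_L2_set)
    also have "\<dots> = L2_set (apply_mat n K (\<lambda>i. x $ i)) {..<n}"
      using A that K by (intro L2_set_cong) (auto simp: apply_mat_def scalar_prod_def lessThan_atLeast0)
    finally show ?thesis .
  qed
  have "(\<lambda>x. euclidean_norm (A *\<^sub>v x)) ` {x \<in> carrier_vec (dim_col A). euclidean_norm x = 1}
      = (\<lambda>x. L2_set (apply_mat n K x) {..<n}) ` {x. L2_set x {..<n} = 1}" (is "?l = ?r")
  proof (intro equalityI subsetI)
    fix y assume "y \<in> ?l"
    then obtain x where "x \<in> carrier_vec n" "euclidean_norm x = 1" "y = euclidean_norm (A *\<^sub>v x)"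
      using A by auto
    thus "y \<in> ?r" using mv[of x] euclidean_norm_eq_L2_set[of x n] by auto
  next
    fix y assume "y \<in> ?r"
    then obtain x where x: "L2_set x {..<n} = 1" "y = L2_set (apply_mat n K x) {..<n}" by auto
    define v where "v = Matrix.vec n x"
    have v: "v \<in> carrier_vec n" by (simp add: v_def)
    have "euclidean_norm v = 1"
      unfolding euclidean_norm_eq_L2_set[OF v] x(1)[symmetric] by (intro L2_set_cong) (auto simp: v_def)
    moreover have "euclidean_norm (A *\<^sub>v v) = y"
      unfolding mv[OF v] x(2) by (intro L2_set_cong) (auto simp: v_def apply_mat_def)
    ultimately show "y \<in> ?l" using v A by auto
  qed
  thus ?thesis unfolding operator_norm_def by simp
qed

text \<open>Cauchy-Schwarz in each row. This Frobenius bound shows that the supremum defining the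
  norm is taken over a bounded set.\<close>

lemma L2_set_apply_mat_le:
  assumes "L2_set x {..<n} = 1"
  shows "L2_set (apply_mat n K x) {..<n} \<le> sqrt (\<Sum>i<n. \<Sum>j<n. (K i j)\<^sup>2)"
proof -
  have "(\<Sum>j<n. (x j)\<^sup>2) = 1" using assms by (simp add: L2_set_def)
  hence "(apply_mat n K x i)\<^sup>2 \<le> (\<Sum>j<n. (K i j)\<^sup>2)" for i
    unfolding apply_mat_def using Cauchy_Schwarz_ineq_sum[of "K i" x "{..<n}"] by simp
  thus ?thesis unfolding L2_set_def by (intro real_sqrt_le_mono sum_mono)
qed

lemma unit_L2_set_nonempty:
  assumes "n \<ge> (1 :: nat)"
  shows "{x. L2_set x {..<n} = 1} \<noteq> {}"
proof -
  have "L2_set (\<lambda>i. if i = 0 then 1 else 0) {..<n} = 1"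
    using assms by (simp add: L2_set_def if_distrib[of "\<lambda>x. x\<^sup>2"] cong: if_cong)
  thus ?thesis by blast
qed

text \<open>Gives access to the supremum through three rules: every unit vector gives a lower bound,
  some unit vector comes arbitrarily close, and a common bound for all unit vectors bounds the
  norm.\<close>

locale square_kernel =
  fixes n :: nat and A :: "real Matrix.mat" and K :: "nat \<Rightarrow> nat \<Rightarrow> real"
  assumes n: "n \<ge> 1" and A: "A \<in> carrier_mat n n"
    and K: "\<And>i j. i < n \<Longrightarrow> j < n \<Longrightarrow> A $$ (i, j) = K i j"
begin

lemma norm_eq: "operator_norm A = (SUP x\<in>{x. L2_set x {..<n} = 1}. L2_set (apply_mat n K x) {..<n})"
  by (rule operator_norm_eq_SUP[OF A]) (rule K)

lemma bdd: "bdd_above ((\<lambda>x. L2_set (apply_mat n K x) {..<n}) ` {x. L2_set x {..<n} = 1})"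
  by (rule bdd_aboveI[of _ "sqrt (\<Sum>i<n. \<Sum>j<n. (K i j)\<^sup>2)"]) (auto intro: L2_set_apply_mat_le)

lemma operator_norm_upper:
  assumes "L2_set x {..<n} = 1"
  shows "L2_set (apply_mat n K x) {..<n} \<le> operator_norm A"
  unfolding norm_eq using assms by (intro cSUP_upper bdd) auto

lemma operator_norm_approx:
  assumes "\<epsilon> > 0"
  obtains x where "L2_set x {..<n} = 1" "operator_norm A < L2_set (apply_mat n K x) {..<n} + \<epsilon>"
proof -
  have "operator_norm A - \<epsilon> < (SUP x\<in>{x. L2_set x {..<n} = 1}. L2_set (apply_mat n K x) {..<n})"
    using assms by (simp add: norm_eq)
  then obtain x where "L2_set x {..<n} = 1" "operator_norm A - \<epsilon> < L2_set (apply_mat n K x) {..<n}"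
    using less_cSUP_iff[OF unit_L2_set_nonempty[OF n] bdd] by auto
  thus ?thesis using that[of x] by simp
qed

lemma operator_norm_least:
  assumes "\<And>x. L2_set x {..<n} = 1 \<Longrightarrow> L2_set (apply_mat n K x) {..<n} \<le> c"
  shows "operator_norm A \<le> c"
  unfolding norm_eq using assms by (intro cSUP_least unit_L2_set_nonempty[OF n]) auto

text \<open>For a symmetric kernel, polarisation recovers the bilinear form at two unit vectors from
  the quadratic form, and the parallelogram law keeps the constant \<open>c\<close>. No eigenvectors
  are involved.\<close>

lemma operator_norm_le_quadratic_form:
  assumes sym: "\<And>i j. K i j = K j i"
    and bnd: "\<And>x. L2_set x {..<n} = 1 \<Longrightarrow> \<bar>\<Sum>i<n. \<Sum>j<n. K i j * (x i * x j)\<bar> \<le> c"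
  shows "operator_norm A \<le> c"
proof -
  define Q where "Q = (\<lambda>x. \<Sum>i<n. \<Sum>j<n. K i j * (x i * x j))"
  have Q: "\<bar>Q x\<bar> \<le> c * (\<Sum>i<n. (x i)\<^sup>2)" for x
  proof (cases "(\<Sum>i<n. (x i)\<^sup>2) = 0")
    case True
    hence "\<And>i. i < n \<Longrightarrow> x i = 0" by (subst (asm) sum_nonneg_eq_0_iff) auto
    thus ?thesis using True by (simp add: Q_def)
  next
    case False
    define l where "l = L2_set x {..<n}"
    have l2: "l\<^sup>2 = (\<Sum>i<n. (x i)\<^sup>2)" by (simp add: l_def L2_set_def sum_nonneg)
    hence l: "l > 0" using False by (metis L2_set_nonneg l_def less_eq_real_def power_zero_numeral)
    have "L2_set (\<lambda>i. x i / l) {..<n} = 1"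
      using l by (simp add: L2_set_def power_divide sum_divide_distrib[symmetric] l2[symmetric])
    hence "\<bar>Q (\<lambda>i. x i / l)\<bar> \<le> c" unfolding Q_def by (rule bnd)
    moreover have "Q (\<lambda>i. x i / l) = Q x / l\<^sup>2"
      by (simp add: Q_def sum_divide_distrib power2_eq_square)
    ultimately show ?thesis using l by (simp add: l2[symmetric] field_simps)
  qed
  show ?thesis
  proof (rule operator_norm_least)
    fix v assume v: "L2_set v {..<n} = 1"
    hence v2: "(\<Sum>i<n. (v i)\<^sup>2) = 1" by (simp add: L2_set_def)
    define w where "w = apply_mat n K v"
    define l where "l = L2_set w {..<n}"
    have l2: "l\<^sup>2 = (\<Sum>i<n. (w i)\<^sup>2)" by (simp add: l_def L2_set_def sum_nonneg)
    have "l \<le> c"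
    proof (cases "l = 0")
      case True
      thus ?thesis using Q[of v] v2 by simp
    next
      case False
      hence l: "l > 0" by (metis L2_set_nonneg l_def less_eq_real_def)
      \<comment> \<open>The unit vector in the direction of the image of \<open>v\<close>: pairing
        it with that image gives exactly its length \<open>l\<close>.\<close>
      define u where "u = (\<lambda>i. w i / l)"
      have u2: "(\<Sum>i<n. (u i)\<^sup>2) = 1"
        using l by (simp add: u_def power_divide sum_divide_distrib[symmetric] l2[symmetric])
      have uw: "(\<Sum>i<n. u i * w i) = l"
        using l by (simp add: u_def sum_divide_distrib[symmetric] power2_eq_square[symmetric] l2[symmetric])
          (simp add: power2_eq_square)
      have uv: "(\<Sum>i<n. \<Sum>j<n. K i j * (u i * v j)) = l"
        unfolding uw[symmetric] w_def apply_mat_def by (simp add: sum_distrib_left mult_ac)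
      have vu: "(\<Sum>i<n. \<Sum>j<n. K i j * (v i * u j)) = l"
        unfolding uv[symmetric] by (subst sum.swap) (simp add: sym mult_ac)
      have "Q (\<lambda>i. u i + v i) - Q (\<lambda>i. u i - v i)
          = 2 * (\<Sum>i<n. \<Sum>j<n. K i j * (u i * v j)) + 2 * (\<Sum>i<n. \<Sum>j<n. K i j * (v i * u j))"
        unfolding Q_def by (simp add: sum_distrib_left sum.distrib[symmetric] sum_subtractf[symmetric] algebra_simps)
      hence "4 * l = Q (\<lambda>i. u i + v i) - Q (\<lambda>i. u i - v i)" using uv vu by simp
      also have "\<dots> \<le> c * (\<Sum>i<n. (u i + v i)\<^sup>2) + c * (\<Sum>i<n. (u i - v i)\<^sup>2)"
        using Q[of "\<lambda>i. u i + v i"] Q[of "\<lambda>i. u i - v i"] by linarith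
      also have "\<dots> = c * ((\<Sum>i<n. (u i + v i)\<^sup>2) + (\<Sum>i<n. (u i - v i)\<^sup>2))" by (simp add: distrib_left)
      also have "(\<Sum>i<n. (u i + v i)\<^sup>2) + (\<Sum>i<n. (u i - v i)\<^sup>2) = 2 * (\<Sum>i<n. (u i)\<^sup>2) + 2 * (\<Sum>i<n. (v i)\<^sup>2)"
        by (simp add: sum_distrib_left sum.distrib[symmetric] power2_eq_square algebra_simps)
      finally show ?thesis using u2 v2 by simp
    qed
    thus "L2_set (apply_mat n K v) {..<n} \<le> c" by (simp add: l_def w_def)
  qed
qed

end

section \<open>The skewed adjacency matrix as a function of the coins\<close>

definition skewed_kernel :: "real \<Rightarrow> nat \<Rightarrow> (nat set \<Rightarrow> bool) \<Rightarrow> nat \<Rightarrow> nat \<Rightarrow> real" where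
  "skewed_kernel a n x i j =
    (if i = j then 0 else if x {Suc i, Suc j} then 1 / 2 else - (1 / 2)) + a / sqrt n"

text \<open>With the coin outcome as argument, adding or removing one edge is the flip of one
  coin.\<close>

definition skewed_norm :: "real \<Rightarrow> nat \<Rightarrow> (nat set \<Rightarrow> bool) \<Rightarrow> real" where
  "skewed_norm a n x = operator_norm (skewed_adj_mat a n {e \<in> possible_edges n. x e})"

lemma possible_edge_Suc: "i < n \<Longrightarrow> j < n \<Longrightarrow> i \<noteq> j \<Longrightarrow> {Suc i, Suc j} \<in> possible_edges n"
  by (auto simp: possible_edges_def)

lemma square_kernel_skewed:
  assumes "n \<ge> 1"
  shows "square_kernel n (skewed_adj_mat a n {e \<in> possible_edges n. x e}) (skewed_kernel a n x)"
proof
  show "skewed_adj_mat a n {e \<in> possible_edges n. x e} \<in> carrier_mat n n"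
    by (auto simp: skewed_adj_mat_def signed_adj_mat_def all_ones_mat_def)
  fix i j assume "i < n" "j < n"
  thus "skewed_adj_mat a n {e \<in> possible_edges n. x e} $$ (i, j) = skewed_kernel a n x i j"
    using possible_edge_Suc[of i n j]
    by (auto simp: skewed_adj_mat_def signed_adj_mat_def all_ones_mat_def skewed_kernel_def)
qed fact

lemma possible_edges_eq_image: "possible_edges n = (\<lambda>(i, j). {Suc i, Suc j}) ` index_pairs n"
proof (intro equalityI subsetI)
  fix e assume "e \<in> possible_edges n"
  then obtain p q where e: "e = {p, q}" "p \<noteq> q" "e \<subseteq> {1..n}"
    by (auto simp: possible_edges_def card_2_iff)
  show "e \<in> (\<lambda>(i, j). {Suc i, Suc j}) ` index_pairs n"
  proof (cases "p < q")
    case True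
    thus ?thesis using e by (intro image_eqI[of _ _ "(p - 1, q - 1)"]) (auto simp: index_pairs_def)
  next
    case False
    thus ?thesis using e by (intro image_eqI[of _ _ "(q - 1, p - 1)"]) (auto simp: index_pairs_def)
  qed
next
  fix e assume "e \<in> (\<lambda>(i, j). {Suc i, Suc j}) ` index_pairs n"
  thus "e \<in> possible_edges n" by (auto simp: index_pairs_def possible_edges_def)
qed

lemma inj_on_index_pairs_edge: "inj_on (\<lambda>(i, j). {Suc i, Suc j}) (index_pairs n)"
  by (auto simp: inj_on_def index_pairs_def doubleton_eq_iff insert_commute)

lemma finite_possible_edges [simp]: "finite (possible_edges n)"
  by (simp add: possible_edges_eq_image)

text \<open>Only the entries at \<open>(i, j)\<close> and \<open>(j, i)\<close> change, each between
  \<open>1/2\<close> and \<open>- 1/2\<close>, that is by \<open>1\<close> in absolute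
  value.\<close>

lemma apply_mat_skewed_flip:
  assumes "(i, j) \<in> index_pairs n"
  shows "(\<Sum>k<n. u k * apply_mat n (skewed_kernel a n x) v k)
      - (\<Sum>k<n. u k * apply_mat n (skewed_kernel a n (flip {Suc i, Suc j} x)) v k)
    = (if x {Suc i, Suc j} then 1 else - 1) * (u i * v j + u j * v i)"
proof -
  define s where "s = (if x {Suc i, Suc j} then 1 else - 1 :: real)"
  have ij: "i < n" "j < n" "i \<noteq> j" using assms by (auto simp: index_pairs_def)
  have D: "skewed_kernel a n x k l - skewed_kernel a n (flip {Suc i, Suc j} x) k l
      = (if l = j then (if k = i then s else 0) else 0) + (if l = i then (if k = j then s else 0) else 0)" for k l
    using ij(3) by (auto simp: skewed_kernel_def flip_def s_def doubleton_eq_iff insert_commute)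
  have "(\<Sum>k<n. u k * apply_mat n (skewed_kernel a n x) v k)
      - (\<Sum>k<n. u k * apply_mat n (skewed_kernel a n (flip {Suc i, Suc j} x)) v k)
     = (\<Sum>k<n. u k * (\<Sum>l<n. (skewed_kernel a n x k l - skewed_kernel a n (flip {Suc i, Suc j} x) k l) * v l))"
    by (simp add: apply_mat_def sum_subtractf left_diff_distrib right_diff_distrib)
  also have "\<dots> = (\<Sum>k<n. u k * ((if k = i then s * v j else 0) + (if k = j then s * v i else 0)))"
    unfolding D using ij
    by (intro sum.cong refl arg_cong2[where f = "(*)"])
      (simp add: distrib_right sum.distrib if_distrib[of "\<lambda>z. z * _"] cong: if_cong)
  also have "\<dots> = s * (u i * v j + u j * v i)"
    using ij by (simp add: distrib_left sum.distrib if_distrib[of "\<lambda>z. _ * z"] algebra_simps cong: if_cong)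
  finally show ?thesis by (simp add: s_def)
qed

text \<open>Flipping an edge changes the norm by at most the change of the bilinear form at a
  near-maximising pair of unit vectors \<open>u\<close>, \<open>v\<close>; only an approximate maximiser is used, which
  worsens the constant from 2 to 4.\<close>

lemma skewed_norm_variation:
  assumes n: "n \<ge> 1"
  shows "(\<Sum>e\<in>possible_edges n. (max 0 (skewed_norm a n x - skewed_norm a n (flip e x)))\<^sup>2) \<le> 4"
proof -
  \<comment> \<open>Small enough that the errors \<open>3 * \<epsilon>\<^sup>2\<close>, summed over
    at most \<open>n\<^sup>2\<close> pairs, contribute at most \<open>3/4\<close>.\<close>
  define \<epsilon> where "\<epsilon> = 1 / (2 * real n)"
  have eps: "\<epsilon> > 0" using n by (simp add: \<epsilon>_def)
  interpret X: square_kernel n "skewed_adj_mat a n {e \<in> possible_edges n. x e}" "skewed_kernel a n x"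
    by (rule square_kernel_skewed[OF n])
  obtain v where v: "L2_set v {..<n} = 1"
    and v': "skewed_norm a n x < L2_set (apply_mat n (skewed_kernel a n x) v) {..<n} + \<epsilon>"
    unfolding skewed_norm_def using X.operator_norm_approx[OF eps] .
  define w where "w = apply_mat n (skewed_kernel a n x) v"
  define l where "l = L2_set w {..<n}"
  \<comment> \<open>If \<open>l = 0\<close>, division by zero makes \<open>u\<close> the zero
    vector; hence only norm at most \<open>1\<close> is claimed for it.\<close>
  define u where "u = (\<lambda>i. w i / l)"
  have l2: "l\<^sup>2 = (\<Sum>i<n. (w i)\<^sup>2)" by (simp add: l_def L2_set_def sum_nonneg)
  have v2: "(\<Sum>i<n. (v i)\<^sup>2) = 1" using v by (simp add: L2_set_def)
  have u2: "(\<Sum>i<n. (u i)\<^sup>2) \<le> 1"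
    by (cases "l = 0") (simp_all add: u_def power_divide sum_divide_distrib[symmetric] l2[symmetric])
  have uw: "(\<Sum>i<n. u i * w i) = l"
  proof -
    have "(\<Sum>i<n. u i * w i) = (\<Sum>i<n. (w i)\<^sup>2) / l"
      by (simp add: u_def sum_divide_distrib power2_eq_square)
    also have "\<dots> = l" unfolding l2[symmetric] by (simp add: power2_eq_square)
    finally show ?thesis .
  qed
  have diff: "max 0 (skewed_norm a n x - skewed_norm a n (flip {Suc i, Suc j} x)) \<le> \<bar>u i * v j + u j * v i\<bar> + \<epsilon>"
    if ij: "(i, j) \<in> index_pairs n" for i j
  proof -
    let ?y = "flip {Suc i, Suc j} x"
    interpret Y: square_kernel n "skewed_adj_mat a n {e \<in> possible_edges n. ?y e}" "skewed_kernel a n ?y"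
      by (rule square_kernel_skewed[OF n])
    let ?z = "apply_mat n (skewed_kernel a n ?y) v"
    have "(\<Sum>k<n. u k * ?z k) \<le> (\<Sum>k<n. \<bar>u k\<bar> * \<bar>?z k\<bar>)"
      by (intro sum_mono) (metis abs_ge_self abs_mult)
    also have "\<dots> \<le> L2_set u {..<n} * L2_set ?z {..<n}" by (rule L2_set_mult_ineq)
    also have "\<dots> \<le> 1 * L2_set ?z {..<n}"
      using u2 by (intro mult_right_mono) (auto simp: L2_set_def sum_nonneg)
    also have "\<dots> \<le> skewed_norm a n ?y" unfolding skewed_norm_def using Y.operator_norm_upper[OF v] by simp
    finally have "skewed_norm a n x - skewed_norm a n ?y \<le> (\<Sum>k<n. u k * w k) - (\<Sum>k<n. u k * ?z k) + \<epsilon>"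
      using v' uw by (simp add: l_def w_def)
    also have "\<dots> = (if x {Suc i, Suc j} then 1 else - 1) * (u i * v j + u j * v i) + \<epsilon>"
      unfolding w_def apply_mat_skewed_flip[OF ij] ..
    also have "\<dots> \<le> \<bar>u i * v j + u j * v i\<bar> + \<epsilon>" by auto
    finally show ?thesis using eps by auto
  qed
  define f where "f = (\<lambda>i j. (u i)\<^sup>2 * (v j)\<^sup>2 + (u j)\<^sup>2 * (v i)\<^sup>2)"
  \<comment> \<open>The full double sum of \<open>f\<close> is twice the product of the squared
    norms of \<open>u\<close> and \<open>v\<close>, and the pairs account for at most half of
    it.\<close>
  have f1: "(\<Sum>(i, j)\<in>index_pairs n. f i j) \<le> 1"
  proof -
    have "(\<Sum>i<n. \<Sum>j<n. f i j) = 2 * (\<Sum>(i, j)\<in>index_pairs n. f i j) + (\<Sum>i<n. f i i)"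
      by (rule sum_index_pairs_symmetric) (simp add: f_def)
    moreover have "(\<Sum>i<n. f i i) \<ge> 0" by (intro sum_nonneg) (simp add: f_def)
    moreover have "(\<Sum>i<n. \<Sum>j<n. f i j) = 2 * ((\<Sum>i<n. (u i)\<^sup>2) * (\<Sum>j<n. (v j)\<^sup>2))"
      unfolding f_def sum_product sum.distrib by (subst (2) sum.swap) simp
    ultimately show ?thesis using u2 v2 by simp
  qed
  have card: "real (card (index_pairs n)) \<le> (real n)\<^sup>2"
  proof -
    have "card (index_pairs n) \<le> card ({..<n} \<times> {..<n})"
      by (rule card_mono) (auto simp: index_pairs_def)
    thus ?thesis by (simp add: power2_eq_square flip: of_nat_mult)
  qed
  have "(\<Sum>e\<in>possible_edges n. (max 0 (skewed_norm a n x - skewed_norm a n (flip e x)))\<^sup>2)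
      = (\<Sum>(i, j)\<in>index_pairs n. (max 0 (skewed_norm a n x - skewed_norm a n (flip {Suc i, Suc j} x)))\<^sup>2)"
    unfolding possible_edges_eq_image
    by (subst sum.reindex[OF inj_on_index_pairs_edge]) (auto intro!: sum.cong)
  also have "\<dots> \<le> (\<Sum>(i, j)\<in>index_pairs n. 3 * f i j + 3 * \<epsilon>\<^sup>2)"
  proof (rule sum_mono, clarsimp)
    fix i j assume ij: "(i, j) \<in> index_pairs n"
    have "(max 0 (skewed_norm a n x - skewed_norm a n (flip {Suc i, Suc j} x)))\<^sup>2 \<le> (\<bar>u i * v j + u j * v i\<bar> + \<epsilon>)\<^sup>2"
      using diff[OF ij] by (intro power_mono) auto
    \<comment> \<open>The weights \<open>3/2\<close> and \<open>3\<close> balance the main term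
      against the error: the total is \<open>3 + 3/4\<close>, below \<open>4\<close>.\<close>
    also have "\<dots> = 3 / 2 * \<bar>u i * v j + u j * v i\<bar>\<^sup>2 + 3 * \<epsilon>\<^sup>2 - (\<bar>u i * v j + u j * v i\<bar> - 2 * \<epsilon>)\<^sup>2 / 2"
      by (simp add: power2_eq_square field_simps)
    also have "\<dots> \<le> 3 / 2 * (u i * v j + u j * v i)\<^sup>2 + 3 * \<epsilon>\<^sup>2" by simp
    also have "\<dots> \<le> 3 / 2 * (2 * f i j) + 3 * \<epsilon>\<^sup>2"
      using zero_le_power2[of "u i * v j - u j * v i"]
      by (intro add_mono mult_left_mono) (auto simp: f_def power2_eq_square algebra_simps)
    finally show "(max 0 (skewed_norm a n x - skewed_norm a n (flip {Suc i, Suc j} x)))\<^sup>2 \<le> 3 * f i j + 3 * \<epsilon>\<^sup>2"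
      by simp
  qed
  also have "\<dots> = 3 * (\<Sum>(i, j)\<in>index_pairs n. f i j) + 3 * (card (index_pairs n) * \<epsilon>\<^sup>2)"
    by (simp add: case_prod_beta sum.distrib sum_distrib_left)
  also have "\<dots> \<le> 3 * 1 + 3 * ((real n)\<^sup>2 * \<epsilon>\<^sup>2)"
    using f1 card by (intro add_mono mult_left_mono mult_right_mono) auto
  also have "(real n)\<^sup>2 * \<epsilon>\<^sup>2 = 1 / 4" using n by (simp add: \<epsilon>_def power_divide power_mult_distrib)
  finally show ?thesis by simp
qed

section \<open>Transfer of the concentration bound to the random graph\<close>

lemma random_graph_eq_map_coins:
  "random_graph n (1 / 2) = map_pmf (\<lambda>x. {e \<in> possible_edges n. x e}) (coins (possible_edges n))"
  by (simp add: random_graph_def coins_def)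

lemma expectation_random_graph:
  "measure_pmf.expectation (random_graph n (1 / 2)) (\<lambda>E. operator_norm (skewed_adj_mat a n E))
    = coin_exp (possible_edges n) (skewed_norm a n)"
  unfolding random_graph_eq_map_coins integral_map_pmf by (simp add: skewed_norm_def[abs_def])

lemma skewed_norm_concentration:
  assumes "n \<ge> 1" "\<epsilon> \<ge> 0"
  shows "measure_pmf.prob (random_graph n (1 / 2))
      {E. operator_norm (skewed_adj_mat a n E) \<ge>
        measure_pmf.expectation (random_graph n (1 / 2)) (\<lambda>E'. operator_norm (skewed_adj_mat a n E')) + \<epsilon>}
    \<le> exp (- \<epsilon>\<^sup>2 / 8)"
proof -
  have "measure_pmf.prob (coins (possible_edges n))
      {x. skewed_norm a n x \<ge> coin_exp (possible_edges n) (skewed_norm a n) + \<epsilon>} \<le> exp (- \<epsilon>\<^sup>2 / (2 * 4))"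
    using assms by (intro coin_concentration skewed_norm_variation) auto
  thus ?thesis
    unfolding expectation_random_graph unfolding random_graph_eq_map_coins
    by (simp add: measure_map_pmf vimage_def skewed_norm_def)
qed

section \<open>The expected norm\<close>

text \<open>The sub-Gaussian bound for a fair sign. It is the auxiliary inequality of Hoeffding's
  lemma with probability \<open>1/2\<close> and argument \<open>2 * c\<close>; negative
  \<open>c\<close> follows since both sides are even.\<close>

lemma exp_pm_half_le:
  fixes c :: real
  shows "(exp c + exp (- c)) / 2 \<le> exp (c\<^sup>2 / 2)"
proof -
  have *: "(exp c + exp (- c)) / 2 \<le> exp (c\<^sup>2 / 2)" if "c \<ge> 0" for c :: real
  proof -
    have pos: "1 + 1 / 2 * (exp (2 * c) - 1) > 0" by (simp add: add_pos_pos field_simps)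
    have "- (2 * c) * (1 / 2) + ln (1 + 1 / 2 * (exp (2 * c) - 1)) \<le> (2 * c)\<^sup>2 / 8"
      using that by (intro Hoeffdings_lemma_aux) auto
    hence "exp (- c + ln (1 + 1 / 2 * (exp (2 * c) - 1))) \<le> exp (c\<^sup>2 / 2)"
      by (simp add: power_mult_distrib)
    also have "exp (- c + ln (1 + 1 / 2 * (exp (2 * c) - 1))) = exp (- c) * (1 + 1 / 2 * (exp (2 * c) - 1))"
      using pos by (simp only: exp_add exp_ln)
    also have "\<dots> = (exp (- c + 2 * c) + exp (- c)) / 2" unfolding exp_add by (simp add: field_simps)
    finally show ?thesis by simp
  qed
  show ?thesis using *[of c] *[of "- c"] by (cases "c \<ge> 0") (auto simp: add.commute)
qed

section \<open>Mean of the smoothed moment generating function\<close>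

definition edge_sign :: "(nat set \<Rightarrow> bool) \<Rightarrow> nat \<times> nat \<Rightarrow> real" where
  "edge_sign x = (\<lambda>(i, j). if x {Suc i, Suc j} then 1 else - 1)"

text \<open>The exponential factorises over the independent edges. Each factor has mean
  \<open>cosh d * exp (- d\<^sup>2 / 2)\<close> with \<open>d = 2 * t * y i * y j\<close>, which is
  at most \<open>1\<close>.\<close>

lemma coin_exp_tilted_form_le:
  assumes "\<sigma> = 1 \<or> \<sigma> = - 1"
  shows "coin_exp (possible_edges n) (\<lambda>x. exp (tilted_form n t (\<lambda>p. \<sigma> * edge_sign x p) y)) \<le> 1"
proof -
  let ?edge = "\<lambda>(i, j). {Suc i, Suc j}"
  define c where "c = (\<lambda>(i, j). 2 * t * (y i * y j))"
  \<comment> \<open>The product formula for \<open>Pi_pmf\<close> is indexed by edges, so the index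
    pair is recovered from the edge by the inverse of the injective pair-to-edge map.\<close>
  define g where "g = (\<lambda>e b. let p = inv_into (index_pairs n) ?edge e in
      exp (c p * (\<sigma> * (if b then 1 else - 1)) - (c p)\<^sup>2 / 2))"
  have inv: "inv_into (index_pairs n) ?edge (?edge p) = p" if "p \<in> index_pairs n" for p
    using inv_into_f_f[OF inj_on_index_pairs_edge that] .
  have prod: "exp (tilted_form n t (\<lambda>p. \<sigma> * edge_sign x p) y) = (\<Prod>e\<in>possible_edges n. g e (x e))" for x
  proof -
    have "exp (tilted_form n t (\<lambda>p. \<sigma> * edge_sign x p) y)
       = (\<Prod>p\<in>index_pairs n. exp (c p * (\<sigma> * (if x (?edge p) then 1 else - 1)) - (c p)\<^sup>2 / 2))"
      unfolding tilted_form_def edge_sign_def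
      by (subst exp_sum)
        (auto simp: c_def power2_eq_square mult_ac intro!: prod.cong)
    also have "\<dots> = (\<Prod>p\<in>index_pairs n. g (?edge p) (x (?edge p)))"
      by (intro prod.cong refl) (simp add: g_def inv Let_def)
    also have "\<dots> = (\<Prod>e\<in>possible_edges n. g e (x e))"
      unfolding possible_edges_eq_image by (subst prod.reindex[OF inj_on_index_pairs_edge]) simp
    finally show ?thesis .
  qed
  have one: "measure_pmf.expectation (bernoulli_pmf (1 / 2)) (g e) \<le> 1" for e
  proof -
    define d where "d = c (inv_into (index_pairs n) ?edge e)"
    have "measure_pmf.expectation (bernoulli_pmf (1 / 2)) (g e) = (g e True + g e False) / 2"
      by (subst integral_measure_pmf[of UNIV]) (auto simp: UNIV_bool)
    also have "\<dots> = (exp d + exp (- d)) / 2 * exp (- (d\<^sup>2 / 2))"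
      using assms by (auto simp: g_def d_def Let_def distrib_right add_divide_distrib simp flip: exp_add)
    also have "\<dots> \<le> exp (d\<^sup>2 / 2) * exp (- (d\<^sup>2 / 2))"
      by (intro mult_right_mono exp_pm_half_le) auto
    finally show ?thesis by (simp flip: exp_add)
  qed
  have gpos: "g e b \<ge> 0" for e b by (simp add: g_def Let_def)
  have "coin_exp (possible_edges n) (\<lambda>x. exp (tilted_form n t (\<lambda>p. \<sigma> * edge_sign x p) y))
      = (\<Prod>e\<in>possible_edges n. measure_pmf.expectation (bernoulli_pmf (1 / 2)) (g e))"
    unfolding prod coins_def
    by (subst expectation_prod_Pi_pmf) (auto simp: gpos intro!: integrable_measure_pmf_finite)
  also have "\<dots> \<le> 1"
    using one gpos by (intro prod_le_1) (auto intro!: Bochner_Integration.integral_nonneg)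
  finally show ?thesis .
qed

definition smoothed_mgf :: "nat \<Rightarrow> real \<Rightarrow> (nat \<Rightarrow> real) \<Rightarrow> real \<Rightarrow> real \<Rightarrow> (nat set \<Rightarrow> bool) \<Rightarrow> real" where
  "smoothed_mgf n t \<mu> \<kappa> \<sigma> x = (\<integral>y. exp (tilted_form n t (\<lambda>p. \<sigma> * edge_sign x p) y) \<partial>normal_vector n \<mu> \<kappa>)"

lemma smoothed_mgf_nonneg: "smoothed_mgf n t \<mu> \<kappa> \<sigma> x \<ge> 0"
  unfolding smoothed_mgf_def by (intro Bochner_Integration.integral_nonneg) auto

text \<open>The coins have finite support, so exchanging the two integrations only needs linearity;
  the bound then holds for each fixed \<open>y\<close>.\<close>

lemma coin_exp_smoothed_mgf_le:
  assumes "\<sigma> = 1 \<or> \<sigma> = - 1" "\<kappa> > 0"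
  shows "coin_exp (possible_edges n) (smoothed_mgf n t \<mu> \<kappa> \<sigma>) \<le> 1"
proof -
  interpret prob_space "normal_vector n \<mu> \<kappa>" by (rule prob_space_normal_vector[OF assms(2)])
  let ?C = "coins (possible_edges n)"
  have finS: "finite (set_pmf ?C)" by (simp add: finite_set_coins)
  define F where "F = (\<lambda>x y. exp (tilted_form n t (\<lambda>p. \<sigma> * edge_sign x p) y))"
  have Fi: "integrable (normal_vector n \<mu> \<kappa>) (F x)" for x
    unfolding F_def
    by (rule integrable_const_bound[where B = "exp (\<Sum>p\<in>index_pairs n. (\<sigma> * edge_sign x p)\<^sup>2 / 2)"])
      (auto intro: tilted_form_le)
  have E: "coin_exp (possible_edges n) f = (\<Sum>x\<in>set_pmf ?C. pmf ?C x * f x)" for f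
    by (subst integral_measure_pmf[OF finS]) auto
  have "coin_exp (possible_edges n) (smoothed_mgf n t \<mu> \<kappa> \<sigma>)
      = (\<Sum>x\<in>set_pmf ?C. pmf ?C x * (\<integral>y. F x y \<partial>normal_vector n \<mu> \<kappa>))"
    unfolding E smoothed_mgf_def F_def ..
  also have "\<dots> = (\<integral>y. (\<Sum>x\<in>set_pmf ?C. pmf ?C x * F x y) \<partial>normal_vector n \<mu> \<kappa>)"
    using Fi by (subst Bochner_Integration.integral_sum) auto
  also have "\<dots> \<le> (\<integral>y. 1 \<partial>normal_vector n \<mu> \<kappa>)"
  proof (rule integral_mono)
    show "integrable (normal_vector n \<mu> \<kappa>) (\<lambda>y. \<Sum>x\<in>set_pmf ?C. pmf ?C x * F x y)" using Fi by auto
    show "(\<Sum>x\<in>set_pmf ?C. pmf ?C x * F x y) \<le> 1" for y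
      unfolding E[symmetric] F_def by (rule coin_exp_tilted_form_le[OF assms(1)])
  qed simp
  also have "\<dots> = 1" using prob_space by simp
  finally show ?thesis .
qed

text \<open>One prior centre for every multiple of \<open>1/n\<close> in \<open>[-1, 1]\<close>, as the component of the
  test vector along the all-ones direction is not known in advance.\<close>

definition prior_centre :: "nat \<Rightarrow> real \<Rightarrow> int \<Rightarrow> nat \<Rightarrow> real" where
  "prior_centre n r k = (\<lambda>_. sqrt r * (k / n) / sqrt n)"

text \<open>Every term is nonnegative, so this one random variable dominates the term belonging to
  any centre and to either sign of the form.\<close>

definition total_mgf :: "nat \<Rightarrow> real \<Rightarrow> real \<Rightarrow> real \<Rightarrow> (nat set \<Rightarrow> bool) \<Rightarrow> real" where
  "total_mgf n t r \<kappa> x = (\<Sum>k\<in>{- int n..int n}. \<Sum>\<sigma>\<in>{1, - 1}. smoothed_mgf n t (prior_centre n r k) \<kappa> \<sigma> x)"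

text \<open>Jensen's inequality for \<open>ln\<close>, by its tangent at \<open>N\<close>. The sum
  has \<open>2 * (2 * n + 1)\<close> terms of mean at most \<open>1\<close>, so covering all centres
  and signs costs only a logarithm.\<close>

lemma coin_exp_ln_total_mgf_le:
  assumes "\<kappa> > 0" and pos: "\<And>x. total_mgf n t r \<kappa> x > 0"
  shows "coin_exp (possible_edges n) (\<lambda>x. ln (total_mgf n t r \<kappa> x)) \<le> ln (4 * real n + 2)"
proof -
  define N where "N = real (4 * n + 2)"
  have N: "N > 0" by (simp add: N_def)
  have "coin_exp (possible_edges n) (total_mgf n t r \<kappa>)
     = (\<Sum>k\<in>{- int n..int n}. \<Sum>\<sigma>\<in>{1, - 1}. coin_exp (possible_edges n) (smoothed_mgf n t (prior_centre n r k) \<kappa> \<sigma>))"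
    unfolding total_mgf_def[abs_def]
    by (simp add: Bochner_Integration.integral_sum)
  also have "\<dots> \<le> (\<Sum>k\<in>{- int n..int n}. \<Sum>\<sigma>\<in>{1, - 1 :: real}. 1)"
    by (intro sum_mono coin_exp_smoothed_mgf_le assms) auto
  also have "\<dots> = N" by (simp add: N_def)
  finally have le: "coin_exp (possible_edges n) (total_mgf n t r \<kappa>) \<le> N" .
  have "ln (total_mgf n t r \<kappa> x) \<le> total_mgf n t r \<kappa> x / N - 1 + ln N" for x
  proof -
    have "ln (total_mgf n t r \<kappa> x / N) \<le> total_mgf n t r \<kappa> x / N - 1"
      using pos N by (intro ln_le_minus_one) auto
    thus ?thesis using pos[of x] N by (simp add: ln_div)
  qed
  hence "coin_exp (possible_edges n) (\<lambda>x. ln (total_mgf n t r \<kappa> x))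
      \<le> coin_exp (possible_edges n) (\<lambda>x. total_mgf n t r \<kappa> x / N - 1 + ln N)"
    by (intro coin_exp_mono) auto
  also have "\<dots> = coin_exp (possible_edges n) (total_mgf n t r \<kappa>) / N - 1 + ln N" by simp
  also have "\<dots> \<le> ln N" using le N by (simp add: field_simps)
  finally show ?thesis by (simp add: N_def add.commute)
qed

section \<open>A bound for all unit vectors at once\<close>

lemma sum_diff_prior_centre:
  assumes n: "n \<ge> 1" and "r \<ge> 0" and y: "L2_set y {..<n} = 1"
  defines "\<alpha> \<equiv> (\<Sum>i<n. y i) / sqrt n"
  shows "(\<Sum>i<n. (sqrt r * y i - prior_centre n r k i)\<^sup>2) = r * (1 - \<alpha>\<^sup>2 + (\<alpha> - k / n)\<^sup>2)"
proof -
  have y2: "(\<Sum>i<n. (y i)\<^sup>2) = 1" using y by (simp add: L2_set_def)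
  \<comment> \<open>The common entry of \<open>k / n\<close> times the normalised all-ones vector.
    The result is Pythagoras: \<open>y\<close> has squared length
    \<open>1 - \<alpha>\<^sup>2\<close> orthogonally to that vector and component
    \<open>\<alpha>\<close> along it.\<close>
  define q where "q = (real_of_int k / n) / sqrt n"
  have "(\<Sum>i<n. (sqrt r * y i - prior_centre n r k i)\<^sup>2) = (\<Sum>i<n. r * ((y i)\<^sup>2 - 2 * q * y i + q\<^sup>2))"
  proof (intro sum.cong refl)
    fix i
    have eq: "sqrt r * y i - prior_centre n r k i = sqrt r * (y i - q)"
      by (simp add: prior_centre_def q_def right_diff_distrib)
    show "(sqrt r * y i - prior_centre n r k i)\<^sup>2 = r * ((y i)\<^sup>2 - 2 * q * y i + q\<^sup>2)"
      unfolding eq using \<open>r \<ge> 0\<close> by (simp add: power_mult_distrib power2_diff algebra_simps)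
  qed
  also have "\<dots> = r * ((\<Sum>i<n. (y i)\<^sup>2) - 2 * q * (\<Sum>i<n. y i) + n * q\<^sup>2)"
    by (simp add: sum_distrib_left[symmetric] sum.distrib sum_subtractf)
  also have "\<dots> = r * (1 - 2 * (k / n) * \<alpha> + (k / n)\<^sup>2)"
    using n by (simp add: y2 q_def \<alpha>_def power_divide power_mult_distrib)
  finally show ?thesis by (simp add: power2_eq_square algebra_simps)
qed

text \<open>The posterior has mean \<open>sqrt r * y\<close> and variance \<open>(1 - r) / n\<close>
  per coordinate, so its total second moment is \<open>1\<close> and the quartic costs exactly
  \<open>t\<^sup>2\<close>. The other two losses are the relative entropy due to the variance ratio
  \<open>u\<close> and due to the distance of the means.\<close>

lemma quadratic_form_le_total_mgf:
  assumes n: "n \<ge> 1" and r: "0 < r" "r < 1" and u: "u > 0"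
    and y: "L2_set y {..<n} = 1" and \<sigma>: "\<sigma> = 1 \<or> \<sigma> = - 1"
  defines "\<alpha> \<equiv> (\<Sum>i<n. y i) / sqrt n" and "\<kappa> \<equiv> sqrt ((1 - r) / (u * n))"
  shows "exp (t * r * (\<sigma> * (2 * (\<Sum>(i, j)\<in>index_pairs n. edge_sign x (i, j) * (y i * y j)))) - t\<^sup>2
      - n / 2 * (u - 1 - ln u) - n * u * r / (2 * (1 - r)) * (1 - \<alpha>\<^sup>2 + 1 / (real n)\<^sup>2))
    \<le> total_mgf n t r \<kappa> x"
proof -
  have y2: "(\<Sum>i<n. (y i)\<^sup>2) = 1" using y by (simp add: L2_set_def)
  have n0: "real n > 0" using n by simp
  have "\<bar>\<alpha>\<bar> \<le> 1"
  proof -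
    have "(\<Sum>i<n. y i)\<^sup>2 \<le> n" using Cauchy_Schwarz_ineq_sum[of y "\<lambda>_. 1" "{..<n}"] y2 by simp
    hence "\<alpha>\<^sup>2 \<le> 1" using n0 by (simp add: \<alpha>_def power_divide)
    thus ?thesis by (simp add: abs_square_le_1)
  qed
  \<comment> \<open>Rounding down to the grid; as \<open>\<bar>\<alpha>\<bar> \<le> 1\<close>, the
    result stays in the index range of the centres.\<close>
  define k where "k = \<lfloor>\<alpha> * n\<rfloor>"
  have k: "k \<in> {- int n..int n}"
  proof -
    have "- real n \<le> \<alpha> * n" "\<alpha> * n \<le> n"
      using \<open>\<bar>\<alpha>\<bar> \<le> 1\<close> n0 mult_right_mono[of "-1" \<alpha> "real n"] mult_right_mono[of \<alpha> 1 "real n"] by auto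
    thus ?thesis unfolding k_def by (auto simp: le_floor_iff) linarith
  qed
  have "(\<alpha> - k / n)\<^sup>2 \<le> 1 / (real n)\<^sup>2"
  proof -
    have "0 \<le> \<alpha> * n - k" "\<alpha> * n - k \<le> 1" unfolding k_def by linarith+
    hence "(\<alpha> * n - k)\<^sup>2 \<le> 1" by (simp add: abs_square_le_1)
    moreover have "\<alpha> - k / n = (\<alpha> * n - k) / n" using n0 by (simp add: field_simps)
    ultimately show ?thesis using n0 by (simp add: power_divide divide_right_mono)
  qed
  hence dist: "(\<Sum>i<n. (sqrt r * y i - prior_centre n r k i)\<^sup>2) \<le> r * (1 - \<alpha>\<^sup>2 + 1 / (real n)\<^sup>2)"
    unfolding sum_diff_prior_centre[OF n less_imp_le[OF r(1)] y] \<alpha>_def[symmetric]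
    using r by (intro mult_left_mono) auto
  define \<tau> where "\<tau> = sqrt ((1 - r) / n)"
  have \<tau>: "\<tau> > 0" "\<tau>\<^sup>2 = (1 - r) / n" using r n0 by (auto simp: \<tau>_def)
  have \<kappa>: "\<kappa> > 0" "\<kappa>\<^sup>2 = (1 - r) / (u * n)" using r n0 u by (auto simp: \<kappa>_def)
  have "(\<kappa> / \<tau>)\<^sup>2 = 1 / u" using r n0 u by (simp add: power_divide \<kappa> \<tau>)
  hence "ln ((\<kappa> / \<tau>)\<^sup>2) = - ln u" using u by (simp add: ln_div)
  hence lnk: "ln (\<kappa> / \<tau>) = - ln u / 2" using \<kappa> \<tau> by (simp add: ln_realpow)
  let ?B = "2 * (\<Sum>(i, j)\<in>index_pairs n. \<sigma> * edge_sign x (i, j) * (sqrt r * y i * (sqrt r * y j)))"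
  have B: "?B = r * (\<sigma> * (2 * (\<Sum>(i, j)\<in>index_pairs n. edge_sign x (i, j) * (y i * y j))))"
    using r by (simp add: sum_distrib_left case_prod_beta) (intro sum.cong refl, simp add: algebra_simps)
  have norm: "(\<Sum>i<n. (sqrt r * y i)\<^sup>2) + n * \<tau>\<^sup>2 = 1"
    using r n0 y2 by (simp add: power_mult_distrib sum_distrib_left[symmetric] \<tau>)
  have kl: "n * (ln (\<kappa> / \<tau>) - 1 / 2 + \<tau>\<^sup>2 / (2 * \<kappa>\<^sup>2)) = n / 2 * (u - 1 - ln u)"
    using r n0 u by (simp add: lnk \<kappa> \<tau> field_simps)
  have kl2: "(\<Sum>i<n. (sqrt r * y i - prior_centre n r k i)\<^sup>2) / (2 * \<kappa>\<^sup>2)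
      \<le> n * u * r / (2 * (1 - r)) * (1 - \<alpha>\<^sup>2 + 1 / (real n)\<^sup>2)"
  proof -
    have "(\<Sum>i<n. (sqrt r * y i - prior_centre n r k i)\<^sup>2) / (2 * \<kappa>\<^sup>2) \<le> (r * (1 - \<alpha>\<^sup>2 + 1 / (real n)\<^sup>2)) / (2 * \<kappa>\<^sup>2)"
      using dist by (intro divide_right_mono) auto
    also have "\<dots> = n * u * r / (2 * (1 - r)) * (1 - \<alpha>\<^sup>2 + 1 / (real n)\<^sup>2)" unfolding \<kappa>(2) by simp
    finally show ?thesis .
  qed
  have "exp (t * r * (\<sigma> * (2 * (\<Sum>(i, j)\<in>index_pairs n. edge_sign x (i, j) * (y i * y j)))) - t\<^sup>2
      - n / 2 * (u - 1 - ln u) - n * u * r / (2 * (1 - r)) * (1 - \<alpha>\<^sup>2 + 1 / (real n)\<^sup>2))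
    \<le> exp (t * ?B - t\<^sup>2 * ((\<Sum>i<n. (sqrt r * y i)\<^sup>2) + n * \<tau>\<^sup>2)\<^sup>2
      - (n * (ln (\<kappa> / \<tau>) - 1 / 2 + \<tau>\<^sup>2 / (2 * \<kappa>\<^sup>2))
        + (\<Sum>i<n. (sqrt r * y i - prior_centre n r k i)\<^sup>2) / (2 * \<kappa>\<^sup>2)))"
    unfolding B norm kl using kl2 by (simp add: mult.assoc)
  also have "\<dots> \<le> smoothed_mgf n t (prior_centre n r k) \<kappa> \<sigma> x"
    unfolding smoothed_mgf_def
    by (rule exp_quadratic_form_le_integral[OF \<tau>(1) \<kappa>(1), where s = "\<lambda>p. \<sigma> * edge_sign x p" and m = "\<lambda>i. sqrt r * y i"])
  also have "\<dots> \<le> (\<Sum>\<sigma>\<in>{1, - 1}. smoothed_mgf n t (prior_centre n r k) \<kappa> \<sigma> x)"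
    using \<sigma> by (intro member_le_sum smoothed_mgf_nonneg) auto
  also have "\<dots> \<le> total_mgf n t r \<kappa> x"
    unfolding total_mgf_def using k by (intro member_le_sum[of k] sum_nonneg smoothed_mgf_nonneg) auto
  finally show ?thesis .
qed

text \<open>Taking logarithms in \<open>quadratic_form_le_total_mgf\<close> and dividing by
  \<open>2 * t * r\<close> with \<open>t = l * sqrt n\<close> puts every main term at scale
  \<open>sqrt n\<close>. The bound is linear in \<open>\<alpha>\<^sup>2\<close>, which lies between
  \<open>0\<close> and \<open>1\<close>, so the two hypotheses on \<open>b\<close> are its end
  values.\<close>

lemma skewed_norm_le_ln_total_mgf:
  assumes n: "n \<ge> 1" and a: "a \<ge> 0" and r: "0 < r" "r < 1" and u: "u > 0" and l: "l > 0"
    and c: "c = (u - 1 - ln u) / (4 * l * r) + l / (2 * r)" and d: "d = u / (4 * l * (1 - r))"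
    and b: "c + d \<le> b" "c + a \<le> b"
  shows "skewed_norm a n x \<le> sqrt n * (b + d / (real n)\<^sup>2)
    + ln (total_mgf n (l * sqrt n) r (sqrt ((1 - r) / (u * n))) x) / (2 * l * r * sqrt n)"
proof -
  interpret X: square_kernel n "skewed_adj_mat a n {e \<in> possible_edges n. x e}" "skewed_kernel a n x"
    by (rule square_kernel_skewed[OF n])
  define Z where "Z = total_mgf n (l * sqrt n) r (sqrt ((1 - r) / (u * n))) x"
  have n0: "real n > 0" using n by simp
  show ?thesis
    unfolding skewed_norm_def Z_def[symmetric]
  proof (rule X.operator_norm_le_quadratic_form)
    show "skewed_kernel a n x i j = skewed_kernel a n x j i" for i j
      by (simp add: skewed_kernel_def insert_commute)
    fix y :: "nat \<Rightarrow> real" assume y: "L2_set y {..<n} = 1"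
    hence y2: "(\<Sum>i<n. (y i)\<^sup>2) = 1" by (simp add: L2_set_def)
    define \<alpha> where "\<alpha> = (\<Sum>i<n. y i) / sqrt n"
    define B where "B = 2 * (\<Sum>(i, j)\<in>index_pairs n. edge_sign x (i, j) * (y i * y j))"
    \<comment> \<open>The sign that turns \<open>B\<close> into its absolute value, so that the norm
      and not just the largest eigenvalue is bounded.\<close>
    define \<sigma> where "\<sigma> = (if B \<ge> 0 then 1 else - 1 :: real)"
    have s1: "0 \<le> \<alpha>\<^sup>2" "\<alpha>\<^sup>2 \<le> 1"
      using Cauchy_Schwarz_ineq_sum[of y "\<lambda>_. 1" "{..<n}"] y2 n0 by (simp_all add: \<alpha>_def power_divide)
    have form: "(\<Sum>i<n. \<Sum>j<n. skewed_kernel a n x i j * (y i * y j)) = B / 2 + a * sqrt n * \<alpha>\<^sup>2"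
    proof -
      define f where "f = (\<lambda>i j. (if i = j then 0 else if x {Suc i, Suc j} then 1 / 2 else - (1 / 2)) * (y i * y j))"
      have "(\<Sum>i<n. \<Sum>j<n. f i j) = 2 * (\<Sum>(i, j)\<in>index_pairs n. f i j) + (\<Sum>i<n. f i i)"
        by (rule sum_index_pairs_symmetric) (simp add: f_def insert_commute)
      also have "(\<Sum>i<n. f i i) = 0" by (simp add: f_def)
      also have "(\<Sum>(i, j)\<in>index_pairs n. f i j) = (\<Sum>(i, j)\<in>index_pairs n. edge_sign x (i, j) * (y i * y j)) / 2"
        unfolding sum_divide_distrib
        by (intro sum.cong refl) (auto simp: f_def edge_sign_def index_pairs_def)
      finally have f: "(\<Sum>i<n. \<Sum>j<n. f i j) = B / 2" by (simp add: B_def)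
      have "(\<Sum>i<n. \<Sum>j<n. skewed_kernel a n x i j * (y i * y j))
          = (\<Sum>i<n. \<Sum>j<n. f i j) + (\<Sum>i<n. \<Sum>j<n. a / sqrt n * (y i * y j))"
        by (simp add: skewed_kernel_def f_def distrib_right sum.distrib)
      also have "(\<Sum>i<n. \<Sum>j<n. a / sqrt n * (y i * y j)) = a / sqrt n * (\<Sum>i<n. y i)\<^sup>2"
        unfolding power2_eq_square sum_product by (simp only: sum_distrib_left)
      also have "\<dots> = a * sqrt n * \<alpha>\<^sup>2"
        using n0 by (simp add: \<alpha>_def power_divide field_simps)
      finally show ?thesis using f by simp
    qed
    define t where "t = l * sqrt n"
    have t: "t > 0" "t\<^sup>2 = l\<^sup>2 * n" using l n0 by (auto simp: t_def power_mult_distrib)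
    define w where "w = t\<^sup>2 + n / 2 * (u - 1 - ln u) + n * u * r / (2 * (1 - r)) * (1 - \<alpha>\<^sup>2 + 1 / (real n)\<^sup>2)"
    have "exp (t * r * (\<sigma> * B) - w) \<le> Z"
      using quadratic_form_le_total_mgf[OF n r u y, of \<sigma> t x]
      unfolding \<alpha>_def[symmetric] B_def[symmetric] Z_def t_def[symmetric] w_def
      by (simp add: \<sigma>_def algebra_simps)
    hence "t * r * (\<sigma> * B) - w \<le> ln Z"
      by (metis exp_gt_zero ln_exp ln_le_cancel_iff order_less_le_trans)
    also have "\<sigma> * B = \<bar>B\<bar>" by (simp add: \<sigma>_def)
    finally have "\<bar>B\<bar> / 2 \<le> (w + ln Z) / (2 * (t * r))"
      using t r by (simp add: field_simps)
    also have "\<dots> = w / (2 * (t * r)) + ln Z / (2 * l * r * sqrt n)"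
      by (simp add: add_divide_distrib t_def mult_ac)
    also have "w / (2 * (t * r)) = sqrt n * (c + d * (1 - \<alpha>\<^sup>2 + 1 / (real n)\<^sup>2))"
    proof -
      define q where "q = 1 - \<alpha>\<^sup>2 + 1 / (real n)\<^sup>2"
      have "w = n * (l\<^sup>2 + (u - 1 - ln u) / 2 + u * r / (2 * (1 - r)) * q)"
        unfolding w_def t q_def[symmetric] by (simp add: algebra_simps)
      also have "\<dots> = (sqrt n * sqrt n) * (l\<^sup>2 + (u - 1 - ln u) / 2 + u * r / (2 * (1 - r)) * q)" using n0 by simp
      also have "\<dots> / (2 * (t * r)) = sqrt n * ((l\<^sup>2 + (u - 1 - ln u) / 2 + u * r / (2 * (1 - r)) * q) / (2 * (l * r)))"
      proof -
        have cancel: "(z * z) * v / (2 * (l * z * r)) = z * (v / (2 * (l * r)))" if "z > 0" for z v :: real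
          using that by simp
        show ?thesis unfolding t_def by (rule cancel) (use n0 in simp)
      qed
      also have "(l\<^sup>2 + (u - 1 - ln u) / 2 + u * r / (2 * (1 - r)) * q) / (2 * (l * r)) = c + d * q"
      proof -
        have "l\<^sup>2 / (2 * (l * r)) = l / (2 * r)" using l by (simp add: power2_eq_square)
        moreover have "(u - 1 - ln u) / 2 / (2 * (l * r)) = (u - 1 - ln u) / (4 * l * r)" by simp
        moreover have "u * r / (2 * (1 - r)) * q / (2 * (l * r)) = d * q" using r by (simp add: d mult_ac)
        ultimately show ?thesis unfolding c add_divide_distrib by simp
      qed
      finally show ?thesis by (simp add: q_def)
    qed
    finally have Bl: "\<bar>B\<bar> / 2 \<le> sqrt n * (c + d * (1 - \<alpha>\<^sup>2 + 1 / (real n)\<^sup>2)) + ln Z / (2 * l * r * sqrt n)" .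
    \<comment> \<open>A convex combination of the end values \<open>c + d\<close> and
      \<open>c + a\<close>.\<close>
    have "c + d * (1 - \<alpha>\<^sup>2) + a * \<alpha>\<^sup>2 = (c + d) * (1 - \<alpha>\<^sup>2) + (c + a) * \<alpha>\<^sup>2" by (simp add: algebra_simps)
    also have "\<dots> \<le> b * (1 - \<alpha>\<^sup>2) + b * \<alpha>\<^sup>2" using s1 b by (intro add_mono mult_right_mono) auto
    finally have "c + d * (1 - \<alpha>\<^sup>2) + a * \<alpha>\<^sup>2 \<le> b" by (simp add: algebra_simps)
    hence "sqrt n * (c + d * (1 - \<alpha>\<^sup>2) + a * \<alpha>\<^sup>2 + d / (real n)\<^sup>2) \<le> sqrt n * (b + d / (real n)\<^sup>2)"
      by (intro mult_left_mono) auto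
    moreover have "\<bar>B / 2 + a * sqrt n * \<alpha>\<^sup>2\<bar> \<le> \<bar>B\<bar> / 2 + a * sqrt n * \<alpha>\<^sup>2"
      using a s1(1) by (intro order_trans[OF abs_triangle_ineq]) auto
    ultimately show "\<bar>\<Sum>i<n. \<Sum>j<n. skewed_kernel a n x i j * (y i * y j)\<bar>
        \<le> sqrt n * (b + d / (real n)\<^sup>2) + ln Z / (2 * l * r * sqrt n)"
      unfolding form using Bl by (simp add: algebra_simps)
  qed
qed

lemma total_mgf_pos:
  fixes r u :: real
  assumes n: "n \<ge> 1" and r: "0 < r" "r < 1" and u: "u > 0"
  shows "total_mgf n t r (sqrt ((1 - r) / (u * n))) x > 0"
proof -
  obtain y where y: "L2_set y {..<n} = 1" using unit_L2_set_nonempty[OF n] by auto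
  show ?thesis
    by (rule less_le_trans[OF exp_gt_zero quadratic_form_le_total_mgf[OF n r u y, of 1]]) simp
qed

section \<open>Numerical choice of the parameters\<close>

lemma ln_four_thirds_le: "ln (4 / 3 :: real) \<le> 29 / 100"
proof -
  \<comment> \<open>The quadratic Taylor bound at \<open>29/100\<close> itself stays below
    \<open>4/3\<close>; taken at half the argument and squared it suffices.\<close>
  have "1 + 29 / 200 + (29 / 200)\<^sup>2 / 2 \<le> exp (29 / 200 :: real)" by (rule exp_lower_Taylor_quadratic) simp
  hence "(1 + 29 / 200 + (29 / 200)\<^sup>2 / 2)\<^sup>2 \<le> (exp (29 / 200 :: real))\<^sup>2" by (intro power_mono) auto
  also have "(exp (29 / 200 :: real))\<^sup>2 = exp (29 / 100)" by (simp flip: exp_double)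
  finally have "4 / 3 \<le> exp (29 / 100 :: real)" by (simp add: power2_eq_square)
  thus ?thesis using ln_le_cancel_iff[of "4 / 3 :: real" "exp (29 / 100)"] by simp
qed

text \<open>The parameters minimise, up to rounding, the larger of \<open>c + d\<close> and \<open>c + a\<close>;
  for \<open>a \<ge> 1\<close> both equal \<open>a + 1 / (2 * a)\<close>.\<close>

lemma parameters_exist:
  fixes a :: real
  assumes "a \<ge> 0"
  obtains l r u c d where "l > 0" "0 < r" "r < 1" "u > 0"
    "c = (u - 1 - ln u) / (4 * l * r) + l / (2 * r)" "d = u / (4 * l * (1 - r))"
    "c + d \<le> sqrt (a\<^sup>2 + 5 / 4)" "c + a \<le> sqrt (a\<^sup>2 + 5 / 4)"
proof -
  \<comment> \<open>A bound free of \<open>a\<close> only has to be checked at the left end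
    \<open>a0\<close> of a range of \<open>a\<close>.\<close>
  have lo: "z \<le> sqrt (a\<^sup>2 + 5 / 4)" if "z\<^sup>2 - 5 / 4 \<le> a0\<^sup>2" "0 \<le> a0" "a0 \<le> a" for z a0 :: real
    using that power_mono[of a0 a 2] by (intro real_le_rsqrt) linarith
  \<comment> \<open>After squaring, \<open>a\<^sup>2\<close> cancels and the rest increases with
    \<open>a\<close>, so the right end \<open>a1\<close> is the worst case.\<close>
  have hi: "z + a \<le> sqrt (a\<^sup>2 + 5 / 4)" if "z\<^sup>2 + 2 * z * a1 \<le> 5 / 4" "0 \<le> z" "a \<le> a1" for z a1 :: real
    using that mult_left_mono[of a a1 z] by (intro real_le_rsqrt) (simp add: power2_eq_square algebra_simps)
  have ln2: "ln (2 :: real) \<le> 25 / 36" by (rule ln2_le_25_over_36)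
  consider "a \<le> 36 / 100" | "36 / 100 \<le> a" "a \<le> 3 / 4" | "3 / 4 \<le> a" "a \<le> 1" | "a \<ge> 1" by linarith
  thus ?thesis
  proof cases
    case 1
    define c :: real where "c = (1 / 4 - 1 - ln (1 / 4)) / (4 * (5 / 6) * (3 / 4)) + (5 / 6) / (2 * (3 / 4))"
    have "ln (1 / 4 :: real) = - (2 * ln 2)" using ln_realpow[of 2 2] by (simp add: ln_div)
    hence c: "c \<le> 73 / 90" using ln2 by (simp add: c_def)
    show ?thesis
    proof (rule that[of "5/6" "3/4" "1/4" c "3/10"])
      show "c + 3 / 10 \<le> sqrt (a\<^sup>2 + 5 / 4)"
        using lo[of "10/9" 0] c assms by (simp add: power2_eq_square)
      show "c + a \<le> sqrt (a\<^sup>2 + 5 / 4)"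
        using hi[of "73/90" "36/100"] c 1 by (simp add: power2_eq_square)
    qed (auto simp: c_def)
  next
    case 2
    define c :: real where "c = (1 / 2 - 1 - ln (1 / 2)) / (4 * (3 / 5) * (16 / 25)) + (3 / 5) / (2 * (16 / 25))"
    have "ln (1 / 2 :: real) = - ln 2" by (simp add: ln_div)
    hence c: "c \<le> 5954 / 10000" using ln2 by (simp add: c_def field_simps)
    show ?thesis
    proof (rule that[of "3/5" "16/25" "1/2" c "125/216"])
      show "c + 125 / 216 \<le> sqrt (a\<^sup>2 + 5 / 4)"
        using lo[of "5954/10000 + 125/216" "36/100"] c 2 by (simp add: power2_eq_square)
      show "c + a \<le> sqrt (a\<^sup>2 + 5 / 4)"
        using hi[of "5954/10000" "3/4"] c 2 by (simp add: power2_eq_square)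
    qed (auto simp: c_def)
  next
    case 3
    define c :: real where "c = (3 / 4 - 1 - ln (3 / 4)) / (4 * (1 / 2) * (27 / 50)) + (1 / 2) / (2 * (27 / 50))"
    have "ln (3 / 4 :: real) = - ln (4 / 3)" by (simp add: ln_div)
    hence c: "c \<le> 1 / 2" using ln_four_thirds_le by (simp add: c_def field_simps)
    show ?thesis
    proof (rule that[of "1/2" "27/50" "3/4" c "75/92"])
      show "c + 75 / 92 \<le> sqrt (a\<^sup>2 + 5 / 4)"
        using lo[of "1/2 + 75/92" "3/4"] c 3 by (simp add: power2_eq_square)
      show "c + a \<le> sqrt (a\<^sup>2 + 5 / 4)"
        using hi[of "1/2" 1] c 3 by (simp add: power2_eq_square)
    qed (auto simp: c_def)
  next
    case 4
    \<comment> \<open>With \<open>u = 1\<close> the logarithmic term of \<open>c\<close> vanishes,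
      which gives \<open>c = 1 / (2 * a)\<close> and \<open>d = a\<close>. The comparison with
      \<open>5/4\<close> is an equality at \<open>a = 1\<close>.\<close>
    have "(1 / (2 * a) + a)\<^sup>2 = a\<^sup>2 + 1 + 1 / (4 * a\<^sup>2)"
      using 4 by (simp add: power2_eq_square field_simps)
    also have "\<dots> \<le> a\<^sup>2 + 5 / 4" using 4 by (simp add: field_simps one_le_power)
    finally have *: "1 / (2 * a) + a \<le> sqrt (a\<^sup>2 + 5 / 4)" by (rule real_le_rsqrt)
    show ?thesis
      using 4 * by (intro that[of "1 / (2 * a)" "1/2" 1 "1 / (2 * a)" a]) (auto simp: field_simps)
  qed
qed

section \<open>Averaging the uniform bound over the random graph\<close>

lemma skewed_norm_expectation_le:
  assumes a: "a \<ge> 0"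
  obtains \<eta> :: "nat \<Rightarrow> real" where "\<eta> \<longlonglongrightarrow> 0" "\<And>n. \<eta> n \<ge> 0"
    "\<And>n. n \<ge> 1 \<Longrightarrow> coin_exp (possible_edges n) (skewed_norm a n) \<le> sqrt n * (sqrt (a\<^sup>2 + 5 / 4) + \<eta> n)"
proof -
  obtain l r u c d where p: "l > 0" "0 < r" "r < 1" "u > 0"
    and cd: "c = (u - 1 - ln u) / (4 * l * r) + l / (2 * r)" "d = u / (4 * l * (1 - r))"
    and b: "c + d \<le> sqrt (a\<^sup>2 + 5 / 4)" "c + a \<le> sqrt (a\<^sup>2 + 5 / 4)"
    using parameters_exist[OF a] .
  define b where "b = sqrt (a\<^sup>2 + 5 / 4)"
  \<comment> \<open>The first term is the rounding error of the grid, the second the logarithm of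
    the number of priors and signs. The parameters depend only on \<open>a\<close>, so both vanish
    in the limit.\<close>
  define \<eta> where "\<eta> = (\<lambda>n. d / (real n)\<^sup>2 + ln (4 * real n + 2) / real n / (2 * l * r))"
  have d: "d > 0" using p by (simp add: cd)
  show ?thesis
  proof (rule that)
    have "(\<lambda>n. d / (real n)\<^sup>2) \<longlonglongrightarrow> 0" by real_asymp
    moreover have "(\<lambda>n. ln (4 * real n + 2) / real n) \<longlonglongrightarrow> 0" by real_asymp
    hence "(\<lambda>n. ln (4 * real n + 2) / real n / (2 * l * r)) \<longlonglongrightarrow> 0" by (rule tendsto_divide_zero)
    ultimately show "\<eta> \<longlonglongrightarrow> 0" unfolding \<eta>_def by (rule tendsto_add_zero)
    show "\<eta> n \<ge> 0" for n using d p by (simp add: \<eta>_def)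
    fix n :: nat assume n: "n \<ge> 1"
    hence n0: "real n > 0" by simp
    define \<kappa> where "\<kappa> = sqrt ((1 - r) / (u * n))"
    have \<kappa>: "\<kappa> > 0" using p n0 by (simp add: \<kappa>_def)
    let ?Z = "total_mgf n (l * sqrt n) r \<kappa>"
    have "coin_exp (possible_edges n) (skewed_norm a n)
        \<le> coin_exp (possible_edges n) (\<lambda>x. sqrt n * (b + d / (real n)\<^sup>2) + ln (?Z x) / (2 * l * r * sqrt n))"
      unfolding \<kappa>_def b_def
      by (intro coin_exp_mono skewed_norm_le_ln_total_mgf[OF n a p(2,3,4,1) cd b]) simp
    also have "\<dots> = sqrt n * (b + d / (real n)\<^sup>2) + coin_exp (possible_edges n) (\<lambda>x. ln (?Z x)) / (2 * l * r * sqrt n)"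
      by simp
    also have "\<dots> \<le> sqrt n * (b + d / (real n)\<^sup>2) + ln (4 * real n + 2) / (2 * l * r * sqrt n)"
      using p total_mgf_pos[OF n p(2,3,4)] unfolding \<kappa>_def[symmetric]
      by (intro add_mono divide_right_mono coin_exp_ln_total_mgf_le \<kappa>) auto
    also have "ln (4 * real n + 2) / (2 * l * r * sqrt n) = sqrt n * (ln (4 * real n + 2) / real n / (2 * l * r))"
    proof -
      have "sqrt n / n = 1 / sqrt n" using n0 by (simp add: real_div_sqrt field_simps)
      moreover have "sqrt n * (ln (4 * real n + 2) / real n / (2 * l * r)) = sqrt n / n * (ln (4 * real n + 2) / (2 * l * r))"
        by simp
      ultimately show ?thesis by (simp add: mult_ac)
    qed
    finally show "coin_exp (possible_edges n) (skewed_norm a n) \<le> sqrt n * (sqrt (a\<^sup>2 + 5 / 4) + \<eta> n)"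
      by (simp add: b_def \<eta>_def algebra_simps)
  qed
qed

theorem theorem4:
  fixes a :: real
  assumes "a \<ge> 0"
  shows "(\<exists>\<delta> :: nat \<Rightarrow> real. \<delta> \<longlonglongrightarrow> 0 \<and>
            (\<forall>n\<ge>1. measure_pmf.expectation (random_graph n (1/2))
                       (\<lambda>E. operator_norm (skewed_adj_mat a n E))
                     \<le> sqrt (real n) * sqrt (a\<^sup>2 + 5/4 + \<delta> n))) \<and>
         (\<forall>n\<ge>1. \<forall>\<epsilon>\<ge>0.
            measure_pmf.prob (random_graph n (1/2))
              {E. operator_norm (skewed_adj_mat a n E) \<ge>
                    measure_pmf.expectation (random_graph n (1/2))
                      (\<lambda>E'. operator_norm (skewed_adj_mat a n E')) + \<epsilon>}
            \<le> exp (- \<epsilon>\<^sup>2 / 8))"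
proof
  define b where "b = sqrt (a\<^sup>2 + 5 / 4)"
  obtain \<eta> :: "nat \<Rightarrow> real" where \<eta>: "\<eta> \<longlonglongrightarrow> 0" "\<And>n. \<eta> n \<ge> 0"
    "\<And>n. n \<ge> 1 \<Longrightarrow> coin_exp (possible_edges n) (skewed_norm a n) \<le> sqrt n * (b + \<eta> n)"
    using skewed_norm_expectation_le[OF assms, folded b_def] by blast
  \<comment> \<open>Moves the error inside the root: \<open>a\<^sup>2 + 5/4 + \<delta> n\<close>
    becomes the square of \<open>b + \<eta> n\<close>, and \<open>\<eta> n \<ge> 0\<close> makes the
    root exact.\<close>
  define \<delta> where "\<delta> = (\<lambda>n. 2 * b * \<eta> n + (\<eta> n)\<^sup>2)"
  have "\<delta> \<longlonglongrightarrow> 2 * b * 0 + 0\<^sup>2" unfolding \<delta>_def by (intro tendsto_intros \<eta>)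
  moreover have "sqrt (a\<^sup>2 + 5/4 + \<delta> n) = b + \<eta> n" for n
  proof -
    have "a\<^sup>2 + 5/4 + \<delta> n = (b + \<eta> n)\<^sup>2" by (simp add: \<delta>_def power2_sum b_def add_nonneg_nonneg)
    moreover have "b + \<eta> n \<ge> 0" using \<eta>(2) by (simp add: b_def)
    ultimately show ?thesis by (simp only: real_sqrt_abs abs_of_nonneg)
  qed
  ultimately show "\<exists>\<delta> :: nat \<Rightarrow> real. \<delta> \<longlonglongrightarrow> 0 \<and>
            (\<forall>n\<ge>1. measure_pmf.expectation (random_graph n (1/2))
                       (\<lambda>E. operator_norm (skewed_adj_mat a n E))
                     \<le> sqrt (real n) * sqrt (a\<^sup>2 + 5/4 + \<delta> n))"
    using \<eta>(3) unfolding expectation_random_graph by (intro exI[of _ \<delta>]) auto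
  show "\<forall>n\<ge>1. \<forall>\<epsilon>\<ge>0.
            measure_pmf.prob (random_graph n (1/2))
              {E. operator_norm (skewed_adj_mat a n E) \<ge>
                    measure_pmf.expectation (random_graph n (1/2))
                      (\<lambda>E'. operator_norm (skewed_adj_mat a n E')) + \<epsilon>}
            \<le> exp (- \<epsilon>\<^sup>2 / 8)"
    using skewed_norm_concentration by blast
qed

end
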